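(* Let $\lambda\in\mathbb{C}$ with $|\lambda|<1$, let $d\ge1$, and let $R(z)\in\mathbb{C}(z)^{m\times m}$ be a para-Hermitian rational matrix of the form $$R(z)=R_\lambda(z)+R_0+R_\lambda^*(1/z),\qquad R_\lambda(z)=\sum_{j=1}^d\frac{R_j}{(z-\lambda)^j},\qquad R_0^*=R_0,$$ with constant matrices $R_0,R_1,\dots,R_d\in\mathbb{C}^{m\times m}$ and with $R_d$ invertible. Put $S_j(z):=(\lambda-z)R_j$ and let $M_\lambda(z)$ be the $dm\times dm$ pencil $$M_\lambda(z):=\begin{bmatrix}&&&S_d(z)\\ &&\cdot^{\cdot^{\cdot}}&R_d+S_{d-1}(z)\\ &S_d(z)&\cdot^{\cdot^{\cdot}}&\vdots\\ S_d(z)&R_d+S_{d-1}(z)&\cdots&R_2+S_1(z)\end{bmatrix},$$ i.e. the block matrix whose $(i,j)$ block ($1\le i,j\le d$) is $R_{2d+2-i-j}+S_{2d+1-i-j}(z)$, with the convention $R_k=0$, $S_k=0$ for $k>d$. Let $$F:=\begin{bmatrix}R_d\\ R_{d-1}\\ \vdots\\ R_1\end{bmatrix},\qquad G:=\begin{bmatrix}R_d^*\\ R_{d-1}^*\\ \vdots\\ R_1^*\end{bmatrix}.$$ Then the pencil $$\widehat L_\lambda(z)=\left[\begin{array}{cc|c}0&M_\lambda(z)&F\\ \mathrm{rev}_1M_\lambda^*(z)&0&(1+z)G\\ \hline zF^*&(1+z)G^*&(1+z)R_0\end{array}\right]$$ is a strongly minimal $*$-palindromic linearization of $(1+z)R(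z)$.
   Context: For a rational matrix $R(t)$ with complex coefficients, $R^*(t):=[R(\overline{t})]^*$ (the coefficients are conjugate-transposed, the variable is not conjugated). A square rational matrix $R(z)$ is para-Hermitian if $R^*(z)=R(1/z)$. For constant matrices $^*$ is the conjugate transpose. A pencil is a polynomial matrix of the form $L(z)=zL_1+L_0$. For a rational matrix $H(z)$, $\mathrm{rev}_1 H(z):=zH(1/z)$; a square pencil $L(z)$ is $*$-palindromic if $\mathrm{rev}_1L^*(z)=L(z)$. A linear system matrix is a block-partitioned complex pencil $$L(z)=\begin{bmatrix}-A(z)&B(z)\\ C(z)&D(z)\end{bmatrix}=\begin{bmatrix}-zA_1+A_0& zB_1-B_0\\ zC_1-C_0& zD_1-D_0\end{bmatrix}$$ with $A(z)$ a square regular pencil ($\det A(z)\not\equiv0$). Its transfer function is $D(z)+C(z)A(z)^{-1}B(z)$. It is minimal if $\begin{bmatrix}-A(z_0)&B(z_0)\end{bmatrix}$ has full row rank and $\begin{bmatrix}-A(z_0)\\ C(z_0)\end{bmatrix}$ has full column rank for all $z_0\in\mathbb{C}$; minimal at $\infty$ if $\begin{bmatrix}-A_1&B_1\end{bmatrix}$ has full row rank and $\begin{bmatrix}-A_1\\ C_1\end{bmatrix}$ has full column rank; strongly minimal if both hold. A strongly minimal linearization of $H(z)$ is a strongly minimal linear system matrix with transfer function $H(z)$. In the pencil of the claim the partition lines indicate the blocks: the top-left block is $-A(z)$. *)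

theory Defs
  imports
    "Jordan_Normal_Form.DL_Rank"
    "Jordan_Normal_Form.Gauss_Jordan_Elimination"
    "Jordan_Normal_Form.Schur_Decomposition"
    "HOL-Computational_Algebra.Computational_Algebra"
    "HOL-Computational_Algebra.Field_as_Ring"
begin

section \<open>Rational functions and rational matrices\<close>

type_synonym ratfun = "complex poly fract"
type_synonym ratmat = "complex poly fract mat"

definition rconst :: "complex \<Rightarrow> ratfun" where
  "rconst c = to_fract [:c:]"

text \<open>The indeterminate \<open>z\<close> of \<open>\<complex>(z)\<close>.\<close>
definition rvar :: ratfun where
  "rvar = to_fract [:0, 1:]"

text \<open>
  The next two operations are defined on the normalised representative \<open>(p, q)\<close> of a rational
  function; the lemmas \<open>rat_cnj_Fract\<close> and \<open>rat_recip_Fract\<close> show that any representative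
  gives the same result.
\<close>

text \<open>\<open>f(z)\<close> with conjugated coefficients, that is, the rational function
  \<open>z \<mapsto> cnj (f (cnj z))\<close>.\<close>
definition rat_cnj :: "ratfun \<Rightarrow> ratfun" where
  "rat_cnj f = (case quot_of_fract f of (p, q) \<Rightarrow> Fract (map_poly cnj p) (map_poly cnj q))"

text \<open>\<open>f(1/z)\<close>.\<close>
definition rat_recip :: "ratfun \<Rightarrow> ratfun" where
  "rat_recip f = (case quot_of_fract f of (p, q) \<Rightarrow>
     poly (map_poly rconst p) (1 / rvar) / poly (map_poly rconst q) (1 / rvar))"

lemma Fract_quot_eq:
  fixes p q :: "complex poly"
  assumes "q \<noteq> 0" and "quot_of_fract (Fract p q) = (a, b)"
  shows "b \<noteq> 0" and "a * q = p * b"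
proof -
  show b: "b \<noteq> 0"
    using snd_quot_of_fract_nonzero[of "Fract p q"] assms(2) by simp
  have "Fract a b = Fract p q"
    using Fract_quot_of_fract[of "Fract p q"] assms(2) by simp
  then show "a * q = p * b"
    using b assms(1) by (simp add: eq_fract)
qed

lemma map_poly_hom_mult:
  fixes h :: "complex \<Rightarrow> 'b::idom"
  assumes "h 0 = 0" "\<And>x y. h (x + y) = h x + h y" "\<And>x y. h (x * y) = h x * h y"
  shows "map_poly h (p * q) = map_poly h p * map_poly h q"
proof -
  have "h (sum f A) = (\<Sum>x\<in>A. h (f x))" if "finite A" for f and A :: "nat set"
    using that by (induction A) (simp_all add: assms)
  then show ?thesis
    by (intro poly_eqI) (simp add: coeff_map_poly coeff_mult assms)
qed

lemma rat_cnj_Fract: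
  assumes "q \<noteq> 0"
  shows "rat_cnj (Fract p q) = Fract (map_poly cnj p) (map_poly cnj q)"
proof -
  obtain a b where ab: "quot_of_fract (Fract p q) = (a, b)"
    by fastforce
  note * = Fract_quot_eq[OF assms ab]
  have nz: "map_poly cnj r \<noteq> 0" if "r \<noteq> 0" for r
    using that by (simp add: map_poly_eq_0_iff)
  have "map_poly cnj a * map_poly cnj q = map_poly cnj p * map_poly cnj b"
    using arg_cong[OF *(2), of "map_poly cnj"] by (simp add: map_poly_hom_mult)
  then show ?thesis
    by (simp add: rat_cnj_def ab eq_fract nz * assms)
qed

lemma rconst_hom:
  "rconst 0 = 0" "rconst (x + y) = rconst x + rconst y" "rconst (x * y) = rconst x * rconst y"
  by (simp_all add: rconst_def flip: to_fract_add to_fract_mult)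

lemma poly_rconst_rvar: "poly (map_poly rconst p) rvar = to_fract p"
proof (induction p)
  case (pCons a p)
  have "pCons a p = [:a:] + [:0, 1:] * p"
    by simp
  then have "to_fract (pCons a p) = rconst a + rvar * to_fract p"
    by (simp only: to_fract_add to_fract_mult rconst_def rvar_def)
  then show ?case
    using pCons by (simp add: map_poly_pCons rconst_hom)
qed simp

lemma poly_rconst_recip_nonzero:
  assumes "p \<noteq> 0"
  shows "poly (map_poly rconst p) (1 / rvar) \<noteq> 0"
proof -
  have rz: "rconst c = 0 \<longleftrightarrow> c = 0" for c
    by (simp add: rconst_def)
  have inj: "map_poly rconst r = 0 \<longleftrightarrow> r = 0" for r
    by (simp add: poly_eq_iff coeff_map_poly rconst_hom rz)
  have refl: "reflect_poly (map_poly rconst r) = map_poly rconst (reflect_poly r)" for r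
  proof -
    have "degree (map_poly rconst r) = degree r"
      by (intro degree_map_poly) (simp_all add: rz)
    then show ?thesis
      by (intro poly_eqI) (simp add: coeff_reflect_poly coeff_map_poly rconst_hom)
  qed
  have rv: "rvar \<noteq> 0"
    by (simp add: rvar_def)
  have "poly (reflect_poly (map_poly rconst p)) rvar \<noteq> 0"
    unfolding refl poly_rconst_rvar using assms by simp
  then show ?thesis
    using rv by (simp add: poly_reflect_poly_nz inverse_eq_divide)
qed

lemma rat_recip_Fract:
  assumes "q \<noteq> 0"
  shows "rat_recip (Fract p q) =
    poly (map_poly rconst p) (1 / rvar) / poly (map_poly rconst q) (1 / rvar)"
proof -
  obtain a b where ab: "quot_of_fract (Fract p q) = (a, b)"
    by fastforce
  note * = Fract_quot_eq[OF assms ab]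
  have "map_poly rconst a * map_poly rconst q = map_poly rconst p * map_poly rconst b"
    using arg_cong[OF *(2), of "map_poly rconst"]
    by (simp add: map_poly_hom_mult rconst_hom)
  from arg_cong[OF this, of "\<lambda>r. poly r (1 / rvar)"]
  show ?thesis
    by (simp add: rat_recip_def ab frac_eq_eq poly_rconst_recip_nonzero * assms)
qed

definition const_mat :: "complex mat \<Rightarrow> ratmat" where
  "const_mat = map_mat rconst"

definition poly_to_rat :: "complex poly mat \<Rightarrow> ratmat" where
  "poly_to_rat = map_mat to_fract"

text \<open>\<open>H\<^sup>*(z)\<close>: transposition and conjugation of the coefficients only.\<close>
definition rat_star :: "ratmat \<Rightarrow> ratmat" where
  "rat_star H = transpose_mat (map_mat rat_cnj H)"

text \<open>\<open>H(1/z)\<close>.\<close>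
definition mat_recip :: "ratmat \<Rightarrow> ratmat" where
  "mat_recip = map_mat rat_recip"

definition rev1 :: "ratmat \<Rightarrow> ratmat" where
  "rev1 H = rvar \<cdot>\<^sub>m mat_recip H"

definition para_hermitian :: "ratmat \<Rightarrow> bool" where
  "para_hermitian H \<longleftrightarrow> square_mat H \<and> rat_star H = mat_recip H"

section \<open>Pencils and linear system matrices\<close>

definition is_pencil :: "complex poly mat \<Rightarrow> bool" where
  "is_pencil L \<longleftrightarrow> (\<exists>L1 \<in> carrier_mat (dim_row L) (dim_col L). \<exists>L0 \<in> carrier_mat (dim_row L) (dim_col L).
     L = [:0, 1:] \<cdot>\<^sub>m map_mat (\<lambda>c. [:c:]) L1 + map_mat (\<lambda>c. [:c:]) L0)"

definition star_palindromic :: "ratmat \<Rightarrow> bool" where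
  "star_palindromic L \<longleftrightarrow> square_mat L \<and> (\<exists>P. is_pencil P \<and> L = poly_to_rat P) \<and> rev1 (rat_star L) = L"

definition eval_mat :: "complex poly mat \<Rightarrow> complex \<Rightarrow> complex mat" where
  "eval_mat L z0 = map_mat (\<lambda>p. poly p z0) L"

text \<open>The coefficient \<open>L\<^sub>1\<close> of \<open>z\<close> in a pencil \<open>L(z) = z L\<^sub>1 + L\<^sub>0\<close>.\<close>
definition pencil_lead :: "complex poly mat \<Rightarrow> complex mat" where
  "pencil_lead L = map_mat (\<lambda>p. coeff p 1) L"

definition hcat :: "'a::zero mat \<Rightarrow> 'a mat \<Rightarrow> 'a mat" where
  "hcat A B = four_block_mat A B (0\<^sub>m 0 (dim_col A)) (0\<^sub>m 0 (dim_col B))"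

definition full_row_rank :: "complex mat \<Rightarrow> bool" where
  "full_row_rank A \<longleftrightarrow> vec_space.rank (dim_row A) A = dim_row A"

definition full_column_rank :: "complex mat \<Rightarrow> bool" where
  "full_column_rank A \<longleftrightarrow> vec_space.rank (dim_row A) A = dim_col A"

text \<open>Blocks of a linear system matrix with rows \<open>-A, B\<close> and \<open>C, D\<close>; the sign of \<open>A\<close> is
  put in by \<open>system_matrix\<close>.\<close>
definition linear_system ::
  "complex poly mat \<Rightarrow> complex poly mat \<Rightarrow> complex poly mat \<Rightarrow> complex poly mat \<Rightarrow> bool" where
  "linear_system A B C D \<longleftrightarrow>
     (\<exists>n p q. A \<in> carrier_mat n n \<and> B \<in> carrier_mat n q \<and> C \<in> carrier_mat p n \<and> D \<in> carrier_mat p q) \<and>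
     is_pencil A \<and> is_pencil B \<and> is_pencil C \<and> is_pencil D \<and> det A \<noteq> 0"

definition system_matrix ::
  "complex poly mat \<Rightarrow> complex poly mat \<Rightarrow> complex poly mat \<Rightarrow> complex poly mat \<Rightarrow> complex poly mat" where
  "system_matrix A B C D = four_block_mat (- A) B C D"

definition transfer_function ::
  "complex poly mat \<Rightarrow> complex poly mat \<Rightarrow> complex poly mat \<Rightarrow> complex poly mat \<Rightarrow> ratmat" where
  "transfer_function A B C D =
     poly_to_rat D + poly_to_rat C * the (mat_inverse (poly_to_rat A)) * poly_to_rat B"

definition minimal_system ::
  "complex poly mat \<Rightarrow> complex poly mat \<Rightarrow> complex poly mat \<Rightarrow> bool" where
  "minimal_system A B C \<longleftrightarrow>
     (\<forall>z0. full_row_rank (hcat (- eval_mat A z0) (eval_mat B z0)) \<and>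
           full_column_rank ((- eval_mat A z0) @\<^sub>r eval_mat C z0))"

definition minimal_at_infinity ::
  "complex poly mat \<Rightarrow> complex poly mat \<Rightarrow> complex poly mat \<Rightarrow> bool" where
  "minimal_at_infinity A B C \<longleftrightarrow>
     full_row_rank (hcat (- pencil_lead A) (pencil_lead B)) \<and>
     full_column_rank ((- pencil_lead A) @\<^sub>r pencil_lead C)"

text \<open>The partition of \<open>L\<close> is part of the data: \<open>n\<close> is the size of the top-left block \<open>-A(z)\<close>.\<close>
definition strongly_minimal_linearization :: "nat \<Rightarrow> ratmat \<Rightarrow> ratmat \<Rightarrow> bool" where
  "strongly_minimal_linearization n L H \<longleftrightarrow>
     (\<exists>A B C D. linear_system A B C D \<and> dim_row A = n \<and> L = poly_to_rat (system_matrix A B C D) \<and>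
        minimal_system A B C \<and> minimal_at_infinity A B C \<and>
        transfer_function A B C D = H)"

section \<open>The pencil built from the coefficients\<close>

text \<open>The \<open>p \<times> q\<close> block matrix whose \<open>(i, j)\<close> block, counted from 1, is the \<open>m \<times> m\<close>
  matrix \<open>f i j\<close>.\<close>
definition block_mat :: "nat \<Rightarrow> nat \<Rightarrow> nat \<Rightarrow> (nat \<Rightarrow> nat \<Rightarrow> 'a mat) \<Rightarrow> 'a mat" where
  "block_mat p q m f = mat (p * m) (q * m)
     (\<lambda>(a, b). f (a div m + 1) (b div m + 1) $$ (a mod m, b mod m))"

definition pole_part :: "nat \<Rightarrow> nat \<Rightarrow> complex \<Rightarrow> (nat \<Rightarrow> complex mat) \<Rightarrow> ratmat" where
  "pole_part m d l R = mat m m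
     (\<lambda>(a, b). \<Sum>j=1..d. rconst (R j $$ (a, b)) / (rvar - rconst l) ^ j)"

definition M_pencil :: "nat \<Rightarrow> nat \<Rightarrow> complex \<Rightarrow> (nat \<Rightarrow> complex mat) \<Rightarrow> ratmat" where
  "M_pencil m d l R =
     (let R' = (\<lambda>k. const_mat (if k \<le> d then R k else 0\<^sub>m m m));
          S = (\<lambda>k. (rconst l - rvar) \<cdot>\<^sub>m R' k)
      in block_mat d d m (\<lambda>i j. R' (2*d + 2 - i - j) + S (2*d + 1 - i - j)))"

definition F_mat :: "nat \<Rightarrow> nat \<Rightarrow> (nat \<Rightarrow> complex mat) \<Rightarrow> complex mat" where
  "F_mat m d R = block_mat d 1 m (\<lambda>i j. R (d + 1 - i))"

definition G_mat :: "nat \<Rightarrow> nat \<Rightarrow> (nat \<Rightarrow> complex mat) \<Rightarrow> complex mat" where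
  "G_mat m d R = block_mat d 1 m (\<lambda>i j. mat_adjoint (R (d + 1 - i)))"

definition L_hat :: "nat \<Rightarrow> nat \<Rightarrow> complex \<Rightarrow> (nat \<Rightarrow> complex mat) \<Rightarrow> ratmat" where
  "L_hat m d l R =
     (let M = M_pencil m d l R;
          F = F_mat m d R;
          G = G_mat m d R
      in four_block_mat
           (four_block_mat (0\<^sub>m (d * m) (d * m)) M
                           (rev1 (rat_star M)) (0\<^sub>m (d * m) (d * m)))
           (const_mat F @\<^sub>r ((1 + rvar) \<cdot>\<^sub>m const_mat G))
           (hcat (rvar \<cdot>\<^sub>m const_mat (mat_adjoint F)) ((1 + rvar) \<cdot>\<^sub>m const_mat (mat_adjoint G)))
           ((1 + rvar) \<cdot>\<^sub>m const_mat (R 0)))"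

end

theory Submission
  imports Defs
begin

text \<open>
  The pencil is \<open>z L\<^sub>1 + L\<^sub>0\<close> with \<open>L\<^sub>0 = L\<^sub>1\<^sup>*\<close>, hence palindromic, and the same symmetry turns the row
  rank conditions into column rank conditions. The kernel of the block Hankel matrix \<open>M\<^sub>\<lambda>(z)\<close> stacked
  on \<open>G\<^sup>*\<close> is found by back substitution with the invertible \<open>R\<^sub>d\<close>. For the transfer function, the block
  column \<open>X\<close> with blocks \<open>-(z - \<lambda>)\<^sup>-\<^sup>d I, \<dots>, -(z - \<lambda>)\<^sup>-\<^sup>1 I\<close> satisfies \<open>M\<^sub>\<lambda> X = F\<close> by a telescoping sum, and
  \<open>G\<^sup>* X = - R\<^sub>\<lambda>\<close>. The contribution of \<open>rev\<^sub>1 M\<^sub>\<lambda>\<^sup>*\<close> is obtained from these two identities by the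
  semilinear involution \<open>H \<mapsto> H\<^sup>*(1/z)\<close>.
\<close>

section \<open>The substitution \<open>H \<mapsto> H\<^sup>*(1/z)\<close>\<close>

lemma rat_cnj_rconst [simp]: "rat_cnj (rconst c) = rconst (cnj c)"
  by (simp add: rconst_def to_fract_def rat_cnj_Fract Polynomial.map_poly_pCons)

lemma rat_cnj_rvar [simp]: "rat_cnj rvar = rvar"
  by (simp add: rvar_def to_fract_def rat_cnj_Fract Polynomial.map_poly_pCons)

lemma map_poly_cnj_eq_0_iff: "map_poly cnj p = 0 \<longleftrightarrow> p = 0"
  by (rule map_poly_eq_0_iff) auto

lemma map_poly_cnj_add: "map_poly cnj (p + q) = map_poly cnj p + map_poly cnj q"
  by (rule poly_eqI) (simp add: coeff_map_poly)

lemma rat_cnj_add: "rat_cnj (f + g) = rat_cnj f + rat_cnj g"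
  by (cases f; cases g)
    (simp add: rat_cnj_Fract map_poly_hom_mult map_poly_cnj_add map_poly_cnj_eq_0_iff)

lemma rat_cnj_mult: "rat_cnj (f * g) = rat_cnj f * rat_cnj g"
  by (cases f; cases g) (simp add: rat_cnj_Fract map_poly_hom_mult map_poly_cnj_eq_0_iff)

lemma map_poly_rconst_add: "map_poly rconst (p + q) = map_poly rconst p + map_poly rconst q"
  by (rule poly_eqI) (simp add: coeff_map_poly rconst_hom)

lemma map_poly_rconst_mult: "map_poly rconst (p * q) = map_poly rconst p * map_poly rconst q"
  by (rule map_poly_hom_mult) (simp_all add: rconst_hom)

lemma rat_recip_add: "rat_recip (f + g) = rat_recip f + rat_recip g"
  by (cases f; cases g)
    (simp add: rat_recip_Fract map_poly_rconst_add map_poly_rconst_mult poly_rconst_recip_nonzero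
      add_frac_eq)

lemma rat_recip_mult: "rat_recip (f * g) = rat_recip f * rat_recip g"
  by (cases f; cases g)
    (simp add: rat_recip_Fract map_poly_rconst_mult)

lemma rconst_1 [simp]: "rconst 1 = 1"
  unfolding rconst_def pCons_one by (rule to_fract_1)

lemma rconst_0 [simp]: "rconst 0 = 0"
  by (simp add: rconst_def)

lemma rconst_uminus: "rconst (- c) = - rconst c"
  by (simp add: rconst_def flip: to_fract_uminus)

lemma rvar_nonzero [simp]: "rvar \<noteq> 0"
  by (simp add: rvar_def)

lemma rvar_ne_rconst: "rvar - rconst c \<noteq> 0"
proof
  assume "rvar - rconst c = 0"
  then have "to_fract [:0, 1:] = to_fract [:c:]"
    by (simp add: rvar_def rconst_def)
  then show False
    by simp
qed

lemma rat_recip_rconst [simp]: "rat_recip (rconst c) = rconst c"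
  by (simp add: rconst_def[of c] to_fract_def rat_recip_Fract Polynomial.map_poly_pCons)

lemma rat_recip_rvar [simp]: "rat_recip rvar = 1 / rvar"
proof -
  have "rat_recip rvar = rat_recip (Fract [:0, 1:] 1)"
    by (simp add: rvar_def to_fract_def)
  then show ?thesis
    by (simp add: rat_recip_Fract Polynomial.map_poly_pCons)
qed

text \<open>On the unit circle 1/z is the conjugate of z, so there this is complex conjugation of
  values. The matrix version \<open>para_adjoint\<close> is thus the pointwise adjoint on the
  circle, and para-Hermitian matrices are those that it fixes.\<close>

definition para_conj :: "ratfun \<Rightarrow> ratfun" where
  "para_conj f = rat_recip (rat_cnj f)"

lemma para_conj_add: "para_conj (f + g) = para_conj f + para_conj g"
  and para_conj_mult: "para_conj (f * g) = para_conj f * para_conj g"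
  by (simp_all add: para_conj_def rat_cnj_add rat_cnj_mult rat_recip_add rat_recip_mult)

lemma para_conj_rconst [simp]: "para_conj (rconst c) = rconst (cnj c)"
  by (simp add: para_conj_def)

lemma para_conj_rvar [simp]: "para_conj rvar = 1 / rvar"
  by (simp add: para_conj_def)

lemma para_conj_0 [simp]: "para_conj 0 = 0"
  using para_conj_rconst[of 0] by simp

lemma para_conj_sum: "para_conj (sum f A) = (\<Sum>x\<in>A. para_conj (f x))"
  by (induction A rule: infinite_finite_induct) (simp_all add: para_conj_add)

lemma para_conj_uminus: "para_conj (- f) = - para_conj f"
  by (metis add.right_inverse add_eq_0_iff para_conj_0 para_conj_add)

definition para_adjoint :: "ratmat \<Rightarrow> ratmat" where
  "para_adjoint H = mat_recip (rat_star H)"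

lemma para_adjoint_index:
  "i < dim_col H \<Longrightarrow> j < dim_row H \<Longrightarrow> para_adjoint H $$ (i, j) = para_conj (H $$ (j, i))"
  by (simp add: para_adjoint_def mat_recip_def rat_star_def para_conj_def)

lemma para_adjoint_dim [simp]:
  "dim_row (para_adjoint H) = dim_col H" "dim_col (para_adjoint H) = dim_row H"
  by (simp_all add: para_adjoint_def mat_recip_def rat_star_def)

lemma para_adjoint_carrier [simp]:
  "H \<in> carrier_mat p q \<Longrightarrow> para_adjoint H \<in> carrier_mat q p"
  by (auto simp: para_adjoint_def mat_recip_def rat_star_def)

text \<open>Carries product identities for \<open>M\<close> over to its reversed adjoint
  \<open>N\<close>, so that the inverse of \<open>N\<close> and its share of the transfer function
  need no second computation.\<close>

lemma para_adjoint_mult: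
  assumes "A \<in> carrier_mat p q" "B \<in> carrier_mat q r"
  shows "para_adjoint (A * B) = para_adjoint B * para_adjoint A"
proof -
  have AB: "A * B \<in> carrier_mat p r"
    using assms by simp
  show ?thesis
  proof (rule eq_matI)
    fix i j assume "i < dim_row (para_adjoint B * para_adjoint A)"
      "j < dim_col (para_adjoint B * para_adjoint A)"
    then have ij: "i < r" "j < p"
      using assms by auto
    have "para_adjoint (A * B) $$ (i, j) = para_conj (\<Sum>k<q. A $$ (j, k) * B $$ (k, i))"
      using assms ij by (simp add: para_adjoint_index scalar_prod_def lessThan_atLeast0)
    also have "\<dots> = (\<Sum>k<q. para_adjoint B $$ (i, k) * para_adjoint A $$ (k, j))"
      using assms ij
      by (simp add: para_conj_sum para_conj_mult para_adjoint_index mult.commute)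
    also have "\<dots> = (para_adjoint B * para_adjoint A) $$ (i, j)"
      using assms ij by (simp add: scalar_prod_def lessThan_atLeast0)
    finally show "para_adjoint (A * B) $$ (i, j) = (para_adjoint B * para_adjoint A) $$ (i, j)" .
  qed (use assms in simp_all)
qed

section \<open>Adjoints and full rank\<close>

lemma mat_adjoint_dim [simp]:
  "dim_row (mat_adjoint A) = dim_col A" "dim_col (mat_adjoint A) = dim_row A"
  by (simp_all add: mat_adjoint_def)

lemma mat_adjoint_carrier [simp]: "A \<in> carrier_mat p q \<Longrightarrow> mat_adjoint A \<in> carrier_mat q p"
  by (intro carrier_matI) auto

lemma mat_adjoint_index [simp]:
  "i < dim_col A \<Longrightarrow> j < dim_row A \<Longrightarrow> mat_adjoint A $$ (i, j) = conjugate (A $$ (j, i))"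
  by (simp add: mat_adjoint_def mat_of_rows_index)

lemma mat_adjoint_adjoint [simp]: "mat_adjoint (mat_adjoint A) = A"
  by (rule eq_matI) auto

lemma mat_adjoint_zero [simp]: "mat_adjoint (0\<^sub>m p q) = (0\<^sub>m q p :: complex mat)"
  by (rule eq_matI) auto

lemma mat_adjoint_add:
  fixes A :: "complex mat"
  assumes "A \<in> carrier_mat p q" "B \<in> carrier_mat p q"
  shows "mat_adjoint (A + B) = mat_adjoint A + mat_adjoint B"
  using assms by (intro eq_matI) auto

lemma mat_adjoint_smult:
  fixes A :: "complex mat"
  shows "mat_adjoint (a \<cdot>\<^sub>m A) = cnj a \<cdot>\<^sub>m mat_adjoint A"
  by (rule eq_matI) auto

lemma mat_adjoint_four_block:
  fixes A :: "complex mat"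
  assumes "A \<in> carrier_mat nr1 nc1" "B \<in> carrier_mat nr1 nc2"
    "C \<in> carrier_mat nr2 nc1" "D \<in> carrier_mat nr2 nc2"
  shows "mat_adjoint (four_block_mat A B C D) =
    four_block_mat (mat_adjoint A) (mat_adjoint C) (mat_adjoint B) (mat_adjoint D)"
  using assms by (intro eq_matI) auto

lemma hcat_carrier [simp]:
  "A \<in> carrier_mat p q \<Longrightarrow> B \<in> carrier_mat p r \<Longrightarrow> hcat A B \<in> carrier_mat p (q + r)"
  by (auto simp: hcat_def)

lemma mat_adjoint_hcat:
  fixes A :: "complex mat"
  assumes "A \<in> carrier_mat p q" "B \<in> carrier_mat p r"
  shows "mat_adjoint (hcat A B) = mat_adjoint A @\<^sub>r mat_adjoint B"
  using assms by (intro eq_matI) (auto simp: hcat_def append_rows_def)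

lemma mat_adjoint_append_rows:
  fixes A :: "complex mat"
  assumes "A \<in> carrier_mat p q" "B \<in> carrier_mat r q"
  shows "mat_adjoint (A @\<^sub>r B) = hcat (mat_adjoint A) (mat_adjoint B)"
  using assms by (intro eq_matI) (auto simp: hcat_def append_rows_def)

lemma hcat_mult_vec:
  assumes "A \<in> carrier_mat p q" "B \<in> carrier_mat p r" "x \<in> carrier_vec q" "y \<in> carrier_vec r"
  shows "hcat A B *\<^sub>v (x @\<^sub>v y) = A *\<^sub>v x + B *\<^sub>v y"
proof -
  have "hcat A B *\<^sub>v (x @\<^sub>v y) =
      (A *\<^sub>v x + B *\<^sub>v y) @\<^sub>v (0\<^sub>m 0 (dim_col A) *\<^sub>v x + 0\<^sub>m 0 (dim_col B) *\<^sub>v y)"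
    unfolding hcat_def by (rule four_block_mat_mult_vec) (use assms in auto)
  also have "\<dots> = A *\<^sub>v x + B *\<^sub>v y"
    using assms by (intro eq_vecI) auto
  finally show ?thesis .
qed

text \<open>Makes the Hankel kernel argument available for the adjoint coefficients, whose leading
  one is the adjoint of \<open>R d\<close>.\<close>

lemma invertible_mat_adjoint:
  fixes A :: "complex mat"
  assumes "invertible_mat A"
  shows "invertible_mat (mat_adjoint A)"
proof -
  have adj: "mat_adjoint (X * Y) = mat_adjoint Y * mat_adjoint X" if "dim_col X = dim_row Y"
    for X Y :: "complex mat"
    using that by (intro eq_matI) (auto simp: scalar_prod_def mult.commute)
  have one: "mat_adjoint (1\<^sub>m n) = (1\<^sub>m n :: complex mat)" for n
    by (rule eq_matI) auto
  define n where "n = dim_row A"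
  have A: "A \<in> carrier_mat n n"
    using assms by (auto simp: invertible_mat_def n_def)
  obtain B where B: "A * B = 1\<^sub>m n" "B * A = 1\<^sub>m (dim_row B)"
    using assms by (auto simp: invertible_mat_def inverts_mat_def n_def)
  \<comment> \<open>\<open>inverts_mat\<close> does not fix the shape of \<open>B\<close>; its
    dimensions are read off from the two products.\<close>
  have Bc: "B \<in> carrier_mat n n"
    using arg_cong[OF B(1), of dim_col] arg_cong[OF B(2), of dim_col] A by auto
  have "mat_adjoint A * mat_adjoint B = 1\<^sub>m n"
    using adj[of B A] A B Bc one by simp
  moreover have "mat_adjoint B * mat_adjoint A = 1\<^sub>m n"
    using adj[of A B] A B Bc one by simp
  ultimately show ?thesis
    using A Bc unfolding invertible_mat_def inverts_mat_def by (intro conjI exI[of _ "mat_adjoint B"]) auto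
qed

text \<open>A trivial kernel makes the columns independent. Independence concerns the set of
  columns, so equal columns are excluded first: they would give the kernel vector
  \<open>unit_vec q i - unit_vec q j\<close>.\<close>

lemma full_column_rankI:
  assumes "A \<in> carrier_mat p q"
    and ker: "\<And>v. v \<in> carrier_vec q \<Longrightarrow> A *\<^sub>v v = 0\<^sub>v p \<Longrightarrow> v = 0\<^sub>v q"
  shows "full_column_rank A"
proof -
  interpret vec_space "TYPE(complex)" p .
  have dist: "distinct (cols A)"
  proof (rule ccontr)
    assume "\<not> distinct (cols A)"
    then obtain i j where ij: "i \<noteq> j" "i < q" "j < q" "col A i = col A j"
      using assms(1) by (auto simp: distinct_conv_nth)
    define v where "v = unit_vec q i - (unit_vec q j :: complex vec)"
    have "A *\<^sub>v v = A *\<^sub>v unit_vec q i - A *\<^sub>v unit_vec q j"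
      unfolding v_def by (rule mult_minus_distrib_mat_vec[OF assms(1)]) auto
    also have "\<dots> = 0\<^sub>v p"
    proof (rule eq_vecI)
      fix k assume k: "k < dim_vec (0\<^sub>v p :: complex vec)"
      have "row A k $ i = row A k $ j"
        using ij k assms(1) by (metis carrier_matD dim_vec index_col index_row(1) index_zero_vec(2))
      then show "(A *\<^sub>v unit_vec q i - A *\<^sub>v unit_vec q j) $ k = 0\<^sub>v p $ k"
        using ij k assms(1) by (simp add: scalar_prod_right_unit[of _ q])
    qed (use assms(1) in auto)
    finally have "v = 0\<^sub>v q"
      by (intro ker) (auto simp: v_def)
    moreover have "v $ i = 1"
      using ij by (simp add: v_def)
    ultimately show False
      using ij by simp
  qed
  have "lin_indpt (set (cols A))"
    using lin_depE[OF assms(1) _ dist] ker by metis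
  then show ?thesis
    using lin_indpt_full_rank[OF assms(1) dist] assms(1) by (simp add: full_column_rank_def)
qed

text \<open>The hypothesis makes \<open>A * mat_adjoint A\<close> invertible, and its inverse
  \<open>Q\<close> yields a preimage under \<open>A\<close> of every \<open>y\<close>, so
  \<open>A\<close> is onto. The criterion uses the adjoint because the symmetry of the pencil
  does.\<close>

lemma full_row_rankI:
  assumes A: "A \<in> carrier_mat p q"
    and ker: "\<And>v. v \<in> carrier_vec p \<Longrightarrow> mat_adjoint A *\<^sub>v v = 0\<^sub>v q \<Longrightarrow> v = 0\<^sub>v p"
  shows "full_row_rank A"
proof -
  interpret vec_space "TYPE(complex)" p .
  let ?A = "mat_adjoint A" and ?P = "A * mat_adjoint A"
  have P: "?P \<in> carrier_mat p p" and A': "?A \<in> carrier_mat q p"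
    using A by auto
  have "v = 0\<^sub>v p" if v: "v \<in> carrier_vec p" "?P *\<^sub>v v = 0\<^sub>v p" for v
  proof -
    define w where "w = ?A *\<^sub>v v"
    have w: "w \<in> carrier_vec q"
      using A' v by (auto simp: w_def)
    have Aw: "A *\<^sub>v w = 0\<^sub>v p"
      using v A A' by (simp add: w_def)
    \<comment> \<open>Moving the adjoint across the inner product turns the squared norm of
      \<open>w\<close> into the inner product of \<open>A *\<^sub>v w\<close>, which is zero, with
      \<open>v\<close>.\<close>
    have "w \<bullet>c w = (\<Sum>i<q. w $ i * cnj (\<Sum>j<p. cnj (A $$ (j, i)) * v $ j))"
      using A A' v by (simp add: w_def scalar_prod_def lessThan_atLeast0)
    also have "\<dots> = (\<Sum>i<q. \<Sum>j<p. A $$ (j, i) * w $ i * cnj (v $ j))"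
      by (simp add: sum_distrib_left mult_ac)
    also have "\<dots> = (\<Sum>j<p. \<Sum>i<q. A $$ (j, i) * w $ i * cnj (v $ j))"
      by (rule sum.swap)
    also have "\<dots> = (\<Sum>j<p. (A *\<^sub>v w) $ j * cnj (v $ j))"
      using A w by (simp add: scalar_prod_def lessThan_atLeast0 sum_distrib_right)
    also have "\<dots> = 0"
      by (simp add: Aw)
    finally have "w = 0\<^sub>v q"
      using conjugate_square_eq_0_vec[OF w] by simp
    then show ?thesis
      using ker v by (simp add: w_def)
  qed
  then have "det ?P \<noteq> 0"
    using det_0_iff_vec_prod_zero_field[OF P] by blast
  then obtain Q where Q: "Q \<in> carrier_mat p p" "?P * Q = 1\<^sub>m p"
    using det_non_zero_imp_unit[OF P] by (auto simp: Units_def ring_mat_def)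
  have "col_space A = carrier_vec p"
  proof -
    have "\<exists>x\<in>carrier_vec q. A *\<^sub>v x = y" if y: "y \<in> carrier_vec p" for y
    proof
      have "A *\<^sub>v (?A *\<^sub>v (Q *\<^sub>v y)) = ?P *\<^sub>v (Q *\<^sub>v y)"
        using A A' Q y by (subst assoc_mult_mat_vec[OF A A']) auto
      also have "\<dots> = (?P * Q) *\<^sub>v y"
        using P Q y by (subst assoc_mult_mat_vec[OF P]) auto
      finally show "A *\<^sub>v (?A *\<^sub>v (Q *\<^sub>v y)) = y"
        using Q y by simp
      show "?A *\<^sub>v (Q *\<^sub>v y) \<in> carrier_vec q"
        using A' Q y by auto
    qed
    then show ?thesis
      using A by (auto simp: col_space_eq[OF A])
  qed
  then have sp: "span (set (cols A)) = carrier_vec p"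
    by (simp add: col_space_def)
  have "rank A = p"
    unfolding rank_def sp using dim_is_n by (simp add: module_vec_def)
  then show ?thesis
    using A by (simp add: full_row_rank_def)
qed

section \<open>Pencils\<close>

text \<open>The polynomial form is the one that the system predicates ask for;
  \<open>rat_pencil\<close> is the same object as it occurs in \<open>L_hat\<close> and in transfer
  functions.\<close>

definition pencil :: "complex mat \<Rightarrow> complex mat \<Rightarrow> complex poly mat" where
  "pencil L1 L0 = mat (dim_row L1) (dim_col L1) (\<lambda>(i, j). [:L0 $$ (i, j), L1 $$ (i, j):])"

definition rat_pencil :: "complex mat \<Rightarrow> complex mat \<Rightarrow> ratmat" where
  "rat_pencil L1 L0 = rvar \<cdot>\<^sub>m const_mat L1 + const_mat L0"

lemma pencil_carrier [simp]: "L1 \<in> carrier_mat p q \<Longrightarrow> pencil L1 L0 \<in> carrier_mat p q"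
  by (auto simp: pencil_def)

lemma const_mat_carrier [simp]: "L \<in> carrier_mat p q \<Longrightarrow> const_mat L \<in> carrier_mat p q"
  by (simp add: const_mat_def)

lemma const_mat_dim [simp]: "dim_row (const_mat L) = dim_row L" "dim_col (const_mat L) = dim_col L"
  by (simp_all add: const_mat_def)

lemma rat_pencil_carrier [simp]: "L0 \<in> carrier_mat p q \<Longrightarrow> rat_pencil L1 L0 \<in> carrier_mat p q"
  by (simp add: rat_pencil_def)

lemma rat_pencil_dim [simp]:
  "dim_row (rat_pencil L1 L0) = dim_row L0" "dim_col (rat_pencil L1 L0) = dim_col L0"
  by (simp_all add: rat_pencil_def const_mat_def)

lemma rat_pencil_index:
  assumes "L1 \<in> carrier_mat p q" "L0 \<in> carrier_mat p q" "i < p" "j < q"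
  shows "rat_pencil L1 L0 $$ (i, j) = rvar * rconst (L1 $$ (i, j)) + rconst (L0 $$ (i, j))"
  using assms by (simp add: rat_pencil_def const_mat_def)

lemma is_pencil_pencil:
  assumes "L1 \<in> carrier_mat p q" "L0 \<in> carrier_mat p q"
  shows "is_pencil (pencil L1 L0)"
  unfolding is_pencil_def
proof (intro bexI)
  show "pencil L1 L0 = [:0, 1:] \<cdot>\<^sub>m map_mat (\<lambda>c. [:c:]) L1 + map_mat (\<lambda>c. [:c:]) L0"
    using assms by (intro eq_matI) (auto simp: pencil_def)
qed (use assms in \<open>auto simp: pencil_def\<close>)

lemma poly_to_rat_pencil:
  assumes "L1 \<in> carrier_mat p q" "L0 \<in> carrier_mat p q"
  shows "poly_to_rat (pencil L1 L0) = rat_pencil L1 L0"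
proof -
  have "to_fract [:a, b:] = rvar * rconst b + rconst a" for a b
  proof -
    have "[:a, b:] = [:0, 1:] * [:b:] + [:a:]"
      by simp
    then show ?thesis
      by (simp only: to_fract_add to_fract_mult rconst_def rvar_def)
  qed
  then show ?thesis
    using assms
    by (intro eq_matI) (auto simp: poly_to_rat_def pencil_def rat_pencil_def const_mat_def)
qed

lemma eval_mat_pencil:
  assumes "L1 \<in> carrier_mat p q" "L0 \<in> carrier_mat p q"
  shows "eval_mat (pencil L1 L0) z = z \<cdot>\<^sub>m L1 + L0"
  using assms by (intro eq_matI) (auto simp: eval_mat_def pencil_def)

lemma pencil_lead_pencil: "pencil_lead (pencil L1 L0) = L1"
  by (intro eq_matI) (auto simp: pencil_lead_def pencil_def)

lemma uminus_pencil:
  assumes "L1 \<in> carrier_mat p q" "L0 \<in> carrier_mat p q"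
  shows "- pencil L1 L0 = pencil (- L1) (- L0)"
  using assms by (intro eq_matI) (auto simp: pencil_def)

lemma pencil_four_block:
  assumes "A1 \<in> carrier_mat p q" "B1 \<in> carrier_mat p s" "C1 \<in> carrier_mat r q" "D1 \<in> carrier_mat r s"
    and "A0 \<in> carrier_mat p q" "B0 \<in> carrier_mat p s" "C0 \<in> carrier_mat r q" "D0 \<in> carrier_mat r s"
  shows "pencil (four_block_mat A1 B1 C1 D1) (four_block_mat A0 B0 C0 D0) =
    four_block_mat (pencil A1 A0) (pencil B1 B0) (pencil C1 C0) (pencil D1 D0)"
  using assms by (intro eq_matI) (auto simp: pencil_def)

lemma rat_pencil_four_block:
  assumes "A1 \<in> carrier_mat p q" "B1 \<in> carrier_mat p s" "C1 \<in> carrier_mat r q" "D1 \<in> carrier_mat r s"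
    and "A0 \<in> carrier_mat p q" "B0 \<in> carrier_mat p s" "C0 \<in> carrier_mat r q" "D0 \<in> carrier_mat r s"
  shows "rat_pencil (four_block_mat A1 B1 C1 D1) (four_block_mat A0 B0 C0 D0) =
    four_block_mat (rat_pencil A1 A0) (rat_pencil B1 B0) (rat_pencil C1 C0) (rat_pencil D1 D0)"
  using assms by (intro eq_matI) (auto simp: rat_pencil_def const_mat_def)

lemma para_adjoint_const_mat: "para_adjoint (const_mat H) = const_mat (mat_adjoint H)"
  by (intro eq_matI) (auto simp: para_adjoint_index const_mat_def)

lemma rev1_star_eq_para_adjoint: "rev1 (rat_star H) = rvar \<cdot>\<^sub>m para_adjoint H"
  by (simp add: rev1_def para_adjoint_def)

text \<open>The factor z turns the coefficient of 1/z into the constant term, so the coefficients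
  are exchanged as well as adjoined. Hence a pencil is palindromic exactly when its two coefficients
  are adjoint to each other.\<close>

lemma rev1_star_rat_pencil:
  assumes "L1 \<in> carrier_mat p q" "L0 \<in> carrier_mat p q"
  shows "rev1 (rat_star (rat_pencil L1 L0)) = rat_pencil (mat_adjoint L0) (mat_adjoint L1)"
proof -
  have c: "rat_pencil L1 L0 \<in> carrier_mat p q"
    using assms by simp
  show ?thesis
    unfolding rev1_star_eq_para_adjoint
  proof (rule eq_matI)
    fix i j assume "i < dim_row (rat_pencil (mat_adjoint L0) (mat_adjoint L1))"
      "j < dim_col (rat_pencil (mat_adjoint L0) (mat_adjoint L1))"
    then have ij: "i < q" "j < p"
      using assms by (auto simp: rat_pencil_def const_mat_def)
    then show "(rvar \<cdot>\<^sub>m para_adjoint (rat_pencil L1 L0)) $$ (i, j) =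
        rat_pencil (mat_adjoint L0) (mat_adjoint L1) $$ (i, j)"
      using assms c para_adjoint_carrier[OF c] mat_adjoint_carrier[OF assms(1)]
        mat_adjoint_carrier[OF assms(2)]
      by (simp add: para_adjoint_index rat_pencil_index[of _ p q] rat_pencil_index[of _ q p]
          para_conj_add para_conj_mult distrib_left)
  qed (use para_adjoint_carrier[OF c] assms in \<open>auto simp: rat_pencil_def const_mat_def\<close>)
qed

section \<open>Block Hankel matrices\<close>

definition trunc :: "nat \<Rightarrow> nat \<Rightarrow> (nat \<Rightarrow> 'a::zero mat) \<Rightarrow> nat \<Rightarrow> 'a mat" where
  "trunc m d R k = (if k \<le> d then R k else 0\<^sub>m m m)"

text \<open>\<open>hankel m d k R\<close> is the coefficient of \<open>\<lambda> - z\<close> in \<open>M_pencil\<close> for \<open>k = 1\<close>, and what remains for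
  \<open>k = 0\<close>.\<close>
definition hankel :: "nat \<Rightarrow> nat \<Rightarrow> nat \<Rightarrow> (nat \<Rightarrow> complex mat) \<Rightarrow> complex mat" where
  "hankel m d k R = mat (d * m) (d * m)
     (\<lambda>(a, b). trunc m d R (2 * d - k - a div m - b div m) $$ (a mod m, b mod m))"

text \<open>With the coefficients \<open>R\<close> this is the adjoint of \<open>G\<close>, with
  their adjoints it is that of \<open>F\<close>.\<close>

definition row_blocks :: "nat \<Rightarrow> nat \<Rightarrow> (nat \<Rightarrow> complex mat) \<Rightarrow> complex mat" where
  "row_blocks m d R = mat m (d * m) (\<lambda>(a, b). R (d - b div m) $$ (a, b mod m))"

lemma hankel_carrier [simp]: "hankel m d k R \<in> carrier_mat (d * m) (d * m)"
  by (simp add: hankel_def)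

lemma hankel_dim [simp]: "dim_row (hankel m d k R) = d * m" "dim_col (hankel m d k R) = d * m"
  by (simp_all add: hankel_def)

lemma row_blocks_dim [simp]: "dim_row (row_blocks m d R) = m" "dim_col (row_blocks m d R) = d * m"
  by (simp_all add: row_blocks_def)

lemma block_index_less: "i < d \<Longrightarrow> r < m \<Longrightarrow> i * m + r < d * (m::nat)"
proof -
  assume "i < d" "r < m"
  then have "i * m + r < Suc i * m"
    by simp
  also have "\<dots> \<le> d * m"
    using \<open>i < d\<close> by (intro mult_le_mono1) simp
  finally show ?thesis .
qed

lemma block_index_cases:
  assumes "a < d * (m::nat)"
  obtains i r where "i < d" "r < m" "a = i * m + r"
proof
  have "m > 0"
    using assms by (cases m) auto
  then show "a mod m < m"
    by simp
  show "a div m < d"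
    using assms by (simp add: less_mult_imp_div_less)
  show "a = a div m * m + a mod m"
    by simp
qed

lemma sum_blocks: "(\<Sum>a<d * m. f a) = (\<Sum>i<d. \<Sum>r<m. f (i * m + r))" for f :: "nat \<Rightarrow> 'a::comm_monoid_add"
proof -
  have "(\<Sum>r<m. f (i * m + r)) = sum f {i * m..<i * m + m}" for i
    using sum.shift_bounds_nat_ivl[of f 0 "i * m" m] by (simp add: lessThan_atLeast0 add.commute)
  then show ?thesis
    by (simp add: sum.nat_group)
qed

text \<open>The coefficient index is symmetric in the block row and the block column, so the adjoint
  only acts inside the blocks.\<close>

lemma mat_adjoint_hankel:
  assumes "\<And>k. k \<le> d \<Longrightarrow> R k \<in> carrier_mat m m"
  shows "mat_adjoint (hankel m d k R) = hankel m d k (\<lambda>k. mat_adjoint (R k))"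
proof (rule eq_matI)
  fix a b assume "a < dim_row (hankel m d k (\<lambda>k. mat_adjoint (R k)))"
    "b < dim_col (hankel m d k (\<lambda>k. mat_adjoint (R k)))"
  then have ab: "a < d * m" "b < d * m"
    by (auto simp: hankel_def)
  then have "a mod m < m" "b mod m < m"
    by (auto elim!: block_index_cases)
  with ab show "mat_adjoint (hankel m d k R) $$ (a, b) =
      hankel m d k (\<lambda>k. mat_adjoint (R k)) $$ (a, b)"
    using assms[of "2 * d - k - a div m - b div m"]
    by (auto simp: hankel_def trunc_def add.assoc add.left_commute add.commute)
qed (auto simp: hankel_def)

lemma smult_mat_mult_vec:
  "v \<in> carrier_vec (dim_col A) \<Longrightarrow> (k \<cdot>\<^sub>m A) *\<^sub>v v = k \<cdot>\<^sub>v (A *\<^sub>v v)" for A :: "'a::comm_ring_1 mat"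
  by (intro eq_vecI) auto

context
  fixes m d :: nat and R :: "nat \<Rightarrow> complex mat"
  assumes Rd: "invertible_mat (R d)" and R: "\<And>j. 1 \<le> j \<Longrightarrow> j \<le> d \<Longrightarrow> R j \<in> carrier_mat m m"
    and d: "1 \<le> d"
begin

lemma lead_coeff_injective:
  assumes "\<And>r. r < m \<Longrightarrow> (\<Sum>s<m. R d $$ (r, s) * w s) = 0" and "s < m"
  shows "w s = 0"
proof -
  have A: "R d \<in> carrier_mat m m"
    using R d by simp
  obtain B where B: "R d * B = 1\<^sub>m m" "B * R d = 1\<^sub>m (dim_row B)"
    using Rd A by (auto simp: invertible_mat_def inverts_mat_def)
  have Bc: "B \<in> carrier_mat m m"
  proof (rule carrier_matI)
    show "dim_row B = m"
      using arg_cong[OF B(2), of dim_col] A by simp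
    show "dim_col B = m"
      using arg_cong[OF B(1), of dim_col] by simp
  qed
  define v where "v = vec m w"
  have v: "v \<in> carrier_vec m"
    by (simp add: v_def)
  have "R d *\<^sub>v v = 0\<^sub>v m"
    using A assms by (intro eq_vecI) (auto simp: v_def scalar_prod_def lessThan_atLeast0)
  then have "B *\<^sub>v (R d *\<^sub>v v) = 0\<^sub>v m"
    using Bc by (intro eq_vecI) auto
  moreover have "B *\<^sub>v (R d *\<^sub>v v) = v"
    using A B Bc v by (subst assoc_mult_mat_vec[OF Bc A v, symmetric]) simp
  ultimately have "v $ s = 0"
    using assms(2) by simp
  then show ?thesis
    using assms(2) by (simp add: v_def)
qed

text \<open>Product of the block row R_{d+t}, ..., R_{t+1} with \<open>y\<close>. Coefficients
  beyond R_d vanish, so only the blocks t, ..., d-1 of \<open>y\<close> enter, block t with the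
  factor \<open>R d\<close>: as t varies, the system is block triangular.\<close>

definition shifted :: "(nat \<Rightarrow> complex) \<Rightarrow> nat \<Rightarrow> nat \<Rightarrow> complex" where
  "shifted y t r = (\<Sum>j<d. \<Sum>s<m. trunc m d R (d + t - j) $$ (r, s) * y (j * m + s))"

lemma hankel_mult_vec:
  assumes "v \<in> carrier_vec (d * m)" "i < d" "r < m"
  shows "(hankel m d k R *\<^sub>v v) $ (i * m + r) =
    (\<Sum>j<d. \<Sum>s<m. trunc m d R (2 * d - k - i - j) $$ (r, s) * v $ (j * m + s))"
  using assms block_index_less[OF assms(2,3)] block_index_less[of _ d _ m]
  by (simp add: scalar_prod_def lessThan_atLeast0[symmetric] sum_blocks hankel_def)

lemma row_blocks_mult_vec:
  assumes "v \<in> carrier_vec (d * m)" "r < m"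
  shows "(row_blocks m d R *\<^sub>v v) $ r = shifted (vec_index v) 0 r"
  using assms block_index_less[of _ d _ m]
  by (simp add: scalar_prod_def lessThan_atLeast0[symmetric] sum_blocks row_blocks_def shifted_def trunc_def)

text \<open>All rows involved are the sums \<open>shifted v t\<close>: row \<open>i\<close> of \<open>hankel 0\<close> and of \<open>hankel 1\<close> is the one
  with \<open>t = d - i\<close> and \<open>t = d - 1 - i\<close>, \<open>row_blocks\<close> is the one with \<open>t = 0\<close>, and that with
  \<open>t = d\<close> is void. Hence all of them vanish, and \<open>v\<close> is found by back substitution.\<close>
lemma hankel_kernel:
  assumes v: "v \<in> carrier_vec (d * m)"
    and H: "(a \<cdot>\<^sub>m hankel m d 0 R + b \<cdot>\<^sub>m hankel m d 1 R) *\<^sub>v v = 0\<^sub>v (d * m)"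
    and G: "(c \<cdot>\<^sub>m row_blocks m d R) *\<^sub>v v = 0\<^sub>v m"
    and nz: "b \<noteq> 0 \<or> a \<noteq> 0 \<and> c \<noteq> 0"
  shows "v = 0\<^sub>v (d * m)"
proof -
  let ?e = "shifted (vec_index v)"
  \<comment> \<open>In block row \<open>d - 1 - t\<close> the offset of \<open>hankel 1\<close> is t
    and that of \<open>hankel 0\<close> is one larger.\<close>
  have rec: "a * ?e (Suc t) r + b * ?e t r = 0" if "t < d" "r < m" for t r
  proof -
    have i: "d - 1 - t < d"
      using d by simp
    have *: "a * (hankel m d 0 R *\<^sub>v v) $ ((d - 1 - t) * m + r) +
        b * (hankel m d 1 R *\<^sub>v v) $ ((d - 1 - t) * m + r) = 0"
      using arg_cong[OF H, of "\<lambda>x :: complex vec. x $ ((d - 1 - t) * m + r)"] v block_index_less[OF i that(2)]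
      by (simp add: add_mult_distrib_mat_vec[of _ "d * m" "d * m"] smult_mat_mult_vec
          del: One_nat_def)
    have "2 * d - (d - 1 - t) = Suc (d + t)" "2 * d - 1 - (d - 1 - t) = d + t"
      using that(1) by auto
    with * show ?thesis
      unfolding hankel_mult_vec[OF v i that(2)] by (simp add: shifted_def)
  qed
  have top: "?e d r = 0" if "r < m" for r
    unfolding shifted_def using that by (intro sum.neutral) (auto simp: trunc_def)
  have all: "?e t r = 0" if "t \<le> d" "r < m" for t r
  \<comment> \<open>For nonzero \<open>b\<close> the recursion descends from the void row t = d. For
    \<open>b = 0\<close> it gives every t >= 1 at once, and t = 0 comes from \<open>G\<close>, where
    \<open>c\<close> is nonzero.\<close>
  proof (cases "b = 0")
    case False
    show ?thesis
      using that
    proof (induction "d - t" arbitrary: t)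
      case 0
      then show ?case
        using top by simp
    next
      case (Suc n)
      then have "?e (Suc t) r = 0"
        by (intro Suc.hyps(1)) auto
      then show ?case
        using rec[of t r] Suc False by simp
    qed
  next
    case True
    have "?e 0 r = 0"
      using arg_cong[OF G, of "\<lambda>x :: complex vec. x $ r"] v that(2) row_blocks_mult_vec[OF v that(2)] nz True
      by (simp add: smult_mat_mult_vec)
    then show ?thesis
      using rec[of "t - 1" r] True nz that by (cases t) auto
  qed
  \<comment> \<open>Induction from the last block downwards: in \<open>?e j\<close> the blocks
    before j carry coefficients beyond R_d, those after j are already zero, and what is left is
    \<open>R d\<close> applied to block j.\<close>
  have zero: "v $ (j * m + s) = 0" if "j < d" "s < m" for j s
    using that
  proof (induction "d - j" arbitrary: j s rule: less_induct)
    case less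
    have "(\<Sum>s<m. R d $$ (r, s) * v $ (j * m + s)) = 0" if "r < m" for r
    proof -
      have "0 = ?e j r"
        using all[of j r] less that by simp
      also have "\<dots> = (\<Sum>i<d. if i = j then \<Sum>s<m. R d $$ (r, s) * v $ (j * m + s) else 0)"
        unfolding shifted_def
      proof (intro sum.cong refl)
        fix i assume i: "i \<in> {..<d}"
        consider "i < j" | "i = j" | "i > j"
          by linarith
        then show "(\<Sum>s<m. trunc m d R (d + j - i) $$ (r, s) * v $ (i * m + s)) =
            (if i = j then \<Sum>s<m. R d $$ (r, s) * v $ (j * m + s) else 0)"
        proof cases
          case 3
          then have "v $ (i * m + s) = 0" if "s < m" for s
            using less.hyps[of i s] that i by auto
          then show ?thesis
            using 3 by simp
        qed (use that in \<open>auto simp: trunc_def\<close>)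
      qed
      also have "\<dots> = (\<Sum>s<m. R d $$ (r, s) * v $ (j * m + s))"
        using less by simp
      finally show ?thesis
        by simp
    qed
    then show ?case
      using lead_coeff_injective[of "\<lambda>s. v $ (j * m + s)"] less by blast
  qed
  show ?thesis
  proof (rule eq_vecI)
    fix k assume "k < dim_vec (0\<^sub>v (d * m) :: complex vec)"
    then have k: "k < d * m"
      by simp
    then show "v $ k = 0\<^sub>v (d * m) $ k"
      using zero by (metis block_index_cases index_zero_vec(1))
  qed (use v in auto)
qed

end

section \<open>The system matrix\<close>

lemma four_block_antidiag_mult_vec:
  fixes P Q :: "complex mat"
  assumes "P \<in> carrier_mat n n" "Q \<in> carrier_mat n n" "x \<in> carrier_vec n" "y \<in> carrier_vec n"
  shows "four_block_mat (0\<^sub>m n n) P Q (0\<^sub>m n n) *\<^sub>v (x @\<^sub>v y) = (P *\<^sub>v y) @\<^sub>v (Q *\<^sub>v x)"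
proof -
  have "four_block_mat (0\<^sub>m n n) P Q (0\<^sub>m n n) *\<^sub>v (x @\<^sub>v y) =
      (0\<^sub>m n n *\<^sub>v x + P *\<^sub>v y) @\<^sub>v (Q *\<^sub>v x + 0\<^sub>m n n *\<^sub>v y)"
    by (rule four_block_mat_mult_vec) (use assms in auto)
  also have "0\<^sub>m n n *\<^sub>v x + P *\<^sub>v y = P *\<^sub>v y"
    using assms by (intro eq_vecI) auto
  also have "Q *\<^sub>v x + 0\<^sub>m n n *\<^sub>v y = Q *\<^sub>v x"
    using assms by (intro eq_vecI) auto
  finally show ?thesis .
qed

lemma four_block_antidiag_mult:
  fixes P Q U V :: "'a::comm_ring_1 mat"
  assumes "P \<in> carrier_mat n n" "Q \<in> carrier_mat n n" "U \<in> carrier_mat n n" "V \<in> carrier_mat n n"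
  shows "four_block_mat (0\<^sub>m n n) P Q (0\<^sub>m n n) * four_block_mat (0\<^sub>m n n) U V (0\<^sub>m n n) =
    four_block_mat (P * V) (0\<^sub>m n n) (0\<^sub>m n n) (Q * U)"
proof -
  have "four_block_mat (0\<^sub>m n n) P Q (0\<^sub>m n n) * four_block_mat (0\<^sub>m n n) U V (0\<^sub>m n n) =
      four_block_mat (0\<^sub>m n n * 0\<^sub>m n n + P * V) (0\<^sub>m n n * U + P * 0\<^sub>m n n)
        (Q * 0\<^sub>m n n + 0\<^sub>m n n * V) (Q * U + 0\<^sub>m n n * 0\<^sub>m n n)"
    by (rule mult_four_block_mat) (use assms in auto)
  also have "\<dots> = four_block_mat (P * V) (0\<^sub>m n n) (0\<^sub>m n n) (Q * U)"
    using assms by (intro cong_four_block_mat) auto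
  finally show ?thesis .
qed

text \<open>The product of C, the inverse of A and B, for an antidiagonal inverse: it splits into
  two contributions. Rows and columns are padded with empty blocks so that the rule for four-block
  products applies.\<close>

lemma hcat_mult_antidiag_mult_append_rows:
  fixes P Q U V S T :: "'a::comm_ring_1 mat"
  assumes "P \<in> carrier_mat p n" "Q \<in> carrier_mat p n" "U \<in> carrier_mat n n" "V \<in> carrier_mat n n"
    "S \<in> carrier_mat n q" "T \<in> carrier_mat n q"
  shows "hcat P Q * four_block_mat (0\<^sub>m n n) U V (0\<^sub>m n n) * (S @\<^sub>r T) = Q * V * S + P * U * T"
proof -
  have h: "hcat P Q = four_block_mat P Q (0\<^sub>m 0 n) (0\<^sub>m 0 n)"
    using assms by (simp add: hcat_def)
  have "hcat P Q * four_block_mat (0\<^sub>m n n) U V (0\<^sub>m n n) =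
      four_block_mat (P * 0\<^sub>m n n + Q * V) (P * U + Q * 0\<^sub>m n n)
        (0\<^sub>m 0 n * 0\<^sub>m n n + 0\<^sub>m 0 n * V) (0\<^sub>m 0 n * U + 0\<^sub>m 0 n * 0\<^sub>m n n)"
    unfolding h by (rule mult_four_block_mat) (use assms in auto)
  also have "\<dots> = four_block_mat (Q * V) (P * U) (0\<^sub>m 0 n) (0\<^sub>m 0 n)"
    using assms by (intro cong_four_block_mat) auto
  finally have "hcat P Q * four_block_mat (0\<^sub>m n n) U V (0\<^sub>m n n) * (S @\<^sub>r T) =
      four_block_mat (Q * V) (P * U) (0\<^sub>m 0 n) (0\<^sub>m 0 n) *
      four_block_mat S (0\<^sub>m n 0) T (0\<^sub>m n 0)"
    using assms by (simp add: append_rows_def)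
  also have "\<dots> = four_block_mat (Q * V * S + P * U * T) (Q * V * 0\<^sub>m n 0 + P * U * 0\<^sub>m n 0)
      (0\<^sub>m 0 n * S + 0\<^sub>m 0 n * T) (0\<^sub>m 0 n * 0\<^sub>m n 0 + 0\<^sub>m 0 n * 0\<^sub>m n 0)"
    by (rule mult_four_block_mat) (use assms in auto)
  also have "\<dots> = Q * V * S + P * U * T"
    using assms by (intro eq_matI) auto
  finally show ?thesis .
qed

lemma zero_append_vec: "0\<^sub>v (p + q) = 0\<^sub>v p @\<^sub>v 0\<^sub>v q"
  by (rule eq_vecI) auto

lemma smult_uminus_mat: "a \<cdot>\<^sub>m - A = - (a \<cdot>\<^sub>m A)" for A :: "'a::comm_ring_1 mat"
  by (rule eq_matI) auto

lemma smult_smult_mat: "a \<cdot>\<^sub>m (b \<cdot>\<^sub>m A) = (a * b) \<cdot>\<^sub>m A" for A :: "'a::comm_ring_1 mat"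
  by (rule eq_matI) (auto simp: mult.assoc)

lemma one_smult_mat: "1 \<cdot>\<^sub>m A = A" for A :: "'a::comm_ring_1 mat"
  by (rule eq_matI) auto

section \<open>Coefficient matrices of the pencil and their adjoint symmetry\<close>

locale palindromic_pencil =
  fixes m d :: nat and l :: complex and R :: "nat \<Rightarrow> complex mat"
  assumes Rd: "invertible_mat (R d)" and R: "\<And>j. j \<le> d \<Longrightarrow> R j \<in> carrier_mat m m"
    and d: "1 \<le> d" and l: "cmod l < 1" and R0: "mat_adjoint (R 0) = R 0"
begin

abbreviation "F \<equiv> F_mat m d R"
abbreviation "G \<equiv> G_mat m d R"
abbreviation "Z \<equiv> (0\<^sub>m (d * m) (d * m) :: complex mat)"

text \<open>Coefficients of \<open>hankel 0\<close> plus (l - z) times \<open>hankel 1\<close>,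
  ordered by powers of z.\<close>

definition "M1 = - hankel m d 1 R"
definition "M0 = hankel m d 0 R + l \<cdot>\<^sub>m hankel m d 1 R"
text \<open>\<open>K1\<close> and \<open>K0\<close> are the coefficients of the top-left block, that
  is of -A(z). The adjoints of \<open>M0\<close> and \<open>M1\<close> appear exchanged because
  \<open>rev1\<close> reverses the order of coefficients.\<close>

definition "K1 = four_block_mat Z M1 (mat_adjoint M0) Z"
definition "K0 = four_block_mat Z M0 (mat_adjoint M1) Z"
definition "B1 = 0\<^sub>m (d * m) m @\<^sub>r G"
definition "B0 = F @\<^sub>r G"
definition "C1 = hcat (mat_adjoint F) (mat_adjoint G)"
definition "C0 = hcat (0\<^sub>m m (d * m)) (mat_adjoint G)"

lemma carriers [simp]:
  "R 0 \<in> carrier_mat m m"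
  "F \<in> carrier_mat (d * m) m" "G \<in> carrier_mat (d * m) m"
  "M1 \<in> carrier_mat (d * m) (d * m)" "M0 \<in> carrier_mat (d * m) (d * m)"
  "K1 \<in> carrier_mat (d * m + d * m) (d * m + d * m)"
  "K0 \<in> carrier_mat (d * m + d * m) (d * m + d * m)"
  "B1 \<in> carrier_mat (d * m + d * m) m" "B0 \<in> carrier_mat (d * m + d * m) m"
  "C1 \<in> carrier_mat m (d * m + d * m)" "C0 \<in> carrier_mat m (d * m + d * m)"
proof -
  show F: "F \<in> carrier_mat (d * m) m" and G: "G \<in> carrier_mat (d * m) m"
    by (simp_all add: F_mat_def G_mat_def block_mat_def)
  show M1: "M1 \<in> carrier_mat (d * m) (d * m)" and M0: "M0 \<in> carrier_mat (d * m) (d * m)"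
    by (simp_all add: M1_def M0_def)
  show "K1 \<in> carrier_mat (d * m + d * m) (d * m + d * m)"
    "K0 \<in> carrier_mat (d * m + d * m) (d * m + d * m)"
    by (simp_all add: K1_def K0_def)
  show "B1 \<in> carrier_mat (d * m + d * m) m" "B0 \<in> carrier_mat (d * m + d * m) m"
    unfolding B1_def B0_def using F G by (intro carrier_append_rows; simp)+
  show "C1 \<in> carrier_mat m (d * m + d * m)" "C0 \<in> carrier_mat m (d * m + d * m)"
    unfolding C1_def C0_def using F G by (intro hcat_carrier; simp)+
  show "R 0 \<in> carrier_mat m m"
    using R by simp
qed

lemma dims [simp]:
  "dim_row F = d * m" "dim_col F = m" "dim_row G = d * m" "dim_col G = m"
  "dim_row M1 = d * m" "dim_col M1 = d * m" "dim_row M0 = d * m" "dim_col M0 = d * m"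
  "dim_row K1 = d * m + d * m" "dim_col K1 = d * m + d * m"
  "dim_row K0 = d * m + d * m" "dim_col K0 = d * m + d * m"
  "dim_row B1 = d * m + d * m" "dim_col B1 = m" "dim_row B0 = d * m + d * m" "dim_col B0 = m"
  "dim_row C1 = m" "dim_col C1 = d * m + d * m" "dim_row C0 = m" "dim_col C0 = d * m + d * m"
  using carriers by blast+

text \<open>The symmetry of the pencil, block by block. The exchange of the B and C blocks is what
  turns row rank conditions into column rank conditions.\<close>

lemma adjoint_blocks:
  "mat_adjoint K1 = K0" "mat_adjoint K0 = K1" "mat_adjoint B1 = C0" "mat_adjoint B0 = C1"
  "mat_adjoint C1 = B0" "mat_adjoint C0 = B1"
proof -
  show K: "mat_adjoint K1 = K0"
    unfolding K1_def K0_def by (subst mat_adjoint_four_block) auto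
  show "mat_adjoint K0 = K1"
    by (simp flip: K)
  show B1: "mat_adjoint B1 = C0" unfolding B1_def C0_def
    by (subst mat_adjoint_append_rows[of _ "d * m" m _ "d * m"]) auto
  show B0: "mat_adjoint B0 = C1" unfolding B0_def C1_def
    by (subst mat_adjoint_append_rows[of _ "d * m" m _ "d * m"]) auto
  show "mat_adjoint C1 = B0" "mat_adjoint C0 = B1"
    by (simp_all flip: B0 B1)
qed

section \<open>Kernels of the blocks and the rank conditions\<close>

lemma adjoint_F: "mat_adjoint F = row_blocks m d (\<lambda>k. mat_adjoint (R k))"
proof (rule eq_matI)
  fix a b assume "a < dim_row (row_blocks m d (\<lambda>k. mat_adjoint (R k)))"
    "b < dim_col (row_blocks m d (\<lambda>k. mat_adjoint (R k)))"
  then show "mat_adjoint F $$ (a, b) = row_blocks m d (\<lambda>k. mat_adjoint (R k)) $$ (a, b)"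
    using R[of "d - b div m"] by (auto simp: F_mat_def block_mat_def row_blocks_def elim!: block_index_cases)
qed auto

lemma adjoint_G: "mat_adjoint G = row_blocks m d R"
proof (rule eq_matI)
  fix a b assume "a < dim_row (row_blocks m d R)" "b < dim_col (row_blocks m d R)"
  then show "mat_adjoint G $$ (a, b) = row_blocks m d R $$ (a, b)"
    using R[of "d - b div m"] by (auto simp: G_mat_def block_mat_def row_blocks_def elim!: block_index_cases)
qed auto

text \<open>The matrix equals b times \<open>hankel 0\<close> plus (b l - a) times
  \<open>hankel 1\<close>. The kernel can be nontrivial only at the point z = l, where the row
  \<open>mat_adjoint G\<close> with nonzero factor removes it.\<close>

lemma kernel_M:
  assumes "v \<in> carrier_vec (d * m)" "(a \<cdot>\<^sub>m M1 + b \<cdot>\<^sub>m M0) *\<^sub>v v = 0\<^sub>v (d * m)"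
    and "(c \<cdot>\<^sub>m mat_adjoint G) *\<^sub>v v = 0\<^sub>v m" and "b * l \<noteq> a \<or> b \<noteq> 0 \<and> c \<noteq> 0"
  shows "v = 0\<^sub>v (d * m)"
proof (rule hankel_kernel[of R d m])
  have "a \<cdot>\<^sub>m M1 + b \<cdot>\<^sub>m M0 = b \<cdot>\<^sub>m hankel m d 0 R + (b * l - a) \<cdot>\<^sub>m hankel m d 1 R"
    unfolding M1_def M0_def by (intro eq_matI) (auto simp: algebra_simps)
  then show "(b \<cdot>\<^sub>m hankel m d 0 R + (b * l - a) \<cdot>\<^sub>m hankel m d 1 R) *\<^sub>v v = 0\<^sub>v (d * m)"
    using assms by simp
  show "(c \<cdot>\<^sub>m row_blocks m d R) *\<^sub>v v = 0\<^sub>v m"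
    using assms by (simp add: adjoint_G)
qed (use assms Rd R d in auto)

text \<open>The same with the roles of \<open>a\<close> and \<open>b\<close> exchanged: the
  exceptional point is now z = 1 / cnj l, which lies at infinity for l = 0, and the row
  \<open>mat_adjoint F\<close> deals with it.\<close>

lemma kernel_M_adjoint:
  assumes "v \<in> carrier_vec (d * m)" "(a \<cdot>\<^sub>m mat_adjoint M0 + b \<cdot>\<^sub>m mat_adjoint M1) *\<^sub>v v = 0\<^sub>v (d * m)"
    and "(c \<cdot>\<^sub>m mat_adjoint F) *\<^sub>v v = 0\<^sub>v m" and "a * cnj l \<noteq> b \<or> a \<noteq> 0 \<and> c \<noteq> 0"
  shows "v = 0\<^sub>v (d * m)"
proof (rule hankel_kernel[of "\<lambda>k. mat_adjoint (R k)" d m])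
  let ?R = "\<lambda>k. mat_adjoint (R k)"
  have H: "mat_adjoint (hankel m d k R) = hankel m d k ?R" for k
    using R by (rule mat_adjoint_hankel)
  have "a \<cdot>\<^sub>m mat_adjoint M0 + b \<cdot>\<^sub>m mat_adjoint M1 =
      a \<cdot>\<^sub>m hankel m d 0 ?R + (a * cnj l - b) \<cdot>\<^sub>m hankel m d 1 ?R"
    unfolding M1_def M0_def H[symmetric]
    by (intro eq_matI) (auto simp: algebra_simps)
  then show "(a \<cdot>\<^sub>m hankel m d 0 ?R + (a * cnj l - b) \<cdot>\<^sub>m hankel m d 1 ?R) *\<^sub>v v = 0\<^sub>v (d * m)"
    using assms by simp
  show "(c \<cdot>\<^sub>m row_blocks m d ?R) *\<^sub>v v = 0\<^sub>v m"
    using assms by (simp add: adjoint_F)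
qed (use assms invertible_mat_adjoint[OF Rd] R d in auto)

text \<open>Homogeneous form of the minimality conditions: \<open>(a, b)\<close> is \<open>(z, 1)\<close> for finite \<open>z\<close> and \<open>(1, 0)\<close>
  for \<open>\<infinity>\<close>. Of the two diagonal blocks one is always invertible, since \<open>\<lambda>\<close> and \<open>1 / cnj \<lambda>\<close> differ.\<close>
lemma system_kernel:
  assumes v: "v \<in> carrier_vec (d * m + d * m)" and ab: "a \<noteq> 0 \<or> b \<noteq> 0"
    and K: "(a \<cdot>\<^sub>m K1 + b \<cdot>\<^sub>m K0) *\<^sub>v v = 0\<^sub>v (d * m + d * m)"
    and C: "(a \<cdot>\<^sub>m C1 + b \<cdot>\<^sub>m C0) *\<^sub>v v = 0\<^sub>v m"
  shows "v = 0\<^sub>v (d * m + d * m)"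
proof -
  let ?n = "d * m"
  define x where "x = vec_first v ?n"
  define y where "y = vec_last v ?n"
  have x: "x \<in> carrier_vec ?n" and y: "y \<in> carrier_vec ?n" and vxy: "v = x @\<^sub>v y"
    using v by (simp_all add: x_def y_def)
  let ?M = "a \<cdot>\<^sub>m M1 + b \<cdot>\<^sub>m M0" and ?N = "a \<cdot>\<^sub>m mat_adjoint M0 + b \<cdot>\<^sub>m mat_adjoint M1"
  have "a \<cdot>\<^sub>m K1 + b \<cdot>\<^sub>m K0 = four_block_mat Z ?M ?N Z"
    unfolding K1_def K0_def by (intro eq_matI) auto
  then have eq: "(?M *\<^sub>v y) @\<^sub>v (?N *\<^sub>v x) = 0\<^sub>v ?n @\<^sub>v 0\<^sub>v ?n"
    using K x y by (simp add: vxy four_block_antidiag_mult_vec zero_append_vec)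
  have "?M *\<^sub>v y \<in> carrier_vec ?n"
    by (auto intro!: mult_mat_vec_carrier[OF _ y])
  then have M: "?M *\<^sub>v y = 0\<^sub>v ?n" and N: "?N *\<^sub>v x = 0\<^sub>v ?n"
    using iffD1[OF append_vec_eq[OF _ zero_carrier_vec] eq] by blast+
  have CFG: "a \<cdot>\<^sub>m C1 + b \<cdot>\<^sub>m C0 = hcat (a \<cdot>\<^sub>m mat_adjoint F) ((a + b) \<cdot>\<^sub>m mat_adjoint G)"
    unfolding C1_def C0_def hcat_def by (intro eq_matI) (auto simp: algebra_simps)
  have FG: "(a \<cdot>\<^sub>m mat_adjoint F) *\<^sub>v x + ((a + b) \<cdot>\<^sub>m mat_adjoint G) *\<^sub>v y = 0\<^sub>v m"
    using C x y unfolding vxy CFG by (subst (asm) hcat_mult_vec[of _ m ?n _ ?n]) auto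
  have zero: "(c \<cdot>\<^sub>m mat_adjoint H) *\<^sub>v 0\<^sub>v ?n = 0\<^sub>v m" if "H \<in> carrier_mat ?n m" for c and H :: "complex mat"
    using that by (intro eq_vecI) auto
  have "x = 0\<^sub>v ?n \<and> y = 0\<^sub>v ?n"
  proof (cases "b * l = a")
    case False
    \<comment> \<open>Away from z = l, \<open>c = 0\<close> may be chosen, which makes the condition
      on \<open>G\<close> void.\<close>
    have "y = 0\<^sub>v ?n"
      by (rule kernel_M[OF y M, of 0]) (use False y in auto)
    moreover from this have "(a \<cdot>\<^sub>m mat_adjoint F) *\<^sub>v x = 0\<^sub>v m"
      using FG x zero[of G]
        right_zero_vec[OF mult_mat_vec_carrier[of "a \<cdot>\<^sub>m mat_adjoint F" m ?n x]] by simp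
    \<comment> \<open>If \<open>a = 0\<close>, then \<open>b\<close> is nonzero and the exceptional
      point is avoided; otherwise the factor \<open>a\<close> of the \<open>F\<close> row is
      nonzero.\<close>
    then have "x = 0\<^sub>v ?n"
      by (rule kernel_M_adjoint[OF x N]) (use ab in auto)
    ultimately show ?thesis
      by simp
  next
    case True
    then have b: "b \<noteq> 0"
      using ab by auto
    have "l * cnj l \<noteq> 1"
    proof
      assume "l * cnj l = 1"
      then have "cmod l * cmod l = 1"
        by (metis complex_mod_cnj norm_mult norm_one)
      then show False
        using l mult_strict_mono[of "cmod l" 1 "cmod l" 1] by simp
    qed
    then have "a * cnj l \<noteq> b"
      using True b by (auto simp: mult.assoc)
    then have "x = 0\<^sub>v ?n"
      by (intro kernel_M_adjoint[OF x N, of 0]) (use x in auto)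
    moreover from this have "((a + b) \<cdot>\<^sub>m mat_adjoint G) *\<^sub>v y = 0\<^sub>v m"
      using FG y zero[of F]
        left_zero_vec[OF mult_mat_vec_carrier[of "(a + b) \<cdot>\<^sub>m mat_adjoint G" m ?n y]] by simp
    \<comment> \<open>The factor 1 + z of \<open>G\<close> vanishes only at z = -1, which is not l
      since |l| < 1.\<close>
    moreover have "a + b \<noteq> 0"
    proof -
      have "1 + l \<noteq> 0"
        using l by (metis add_eq_0_iff less_irrefl norm_minus_cancel norm_one)
      moreover have "a + b = b * (1 + l)"
        using True by (simp add: algebra_simps)
      ultimately show ?thesis
        using b by simp
    qed
    then have "y = 0\<^sub>v ?n" if "((a + b) \<cdot>\<^sub>m mat_adjoint G) *\<^sub>v y = 0\<^sub>v m"
      by (intro kernel_M[OF y M that]) (use b in auto)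
    ultimately show ?thesis
      by simp
  qed
  then show ?thesis
    by (auto simp: vxy)
qed

lemma full_column_rank_system:
  assumes "a \<noteq> 0 \<or> b \<noteq> 0"
  shows "full_column_rank ((a \<cdot>\<^sub>m K1 + b \<cdot>\<^sub>m K0) @\<^sub>r (a \<cdot>\<^sub>m C1 + b \<cdot>\<^sub>m C0))"
proof (rule full_column_rankI)
  let ?n = "d * m + d * m"
  have c: "a \<cdot>\<^sub>m K1 + b \<cdot>\<^sub>m K0 \<in> carrier_mat ?n ?n" "a \<cdot>\<^sub>m C1 + b \<cdot>\<^sub>m C0 \<in> carrier_mat m ?n"
    by simp_all
  show "(a \<cdot>\<^sub>m K1 + b \<cdot>\<^sub>m K0) @\<^sub>r (a \<cdot>\<^sub>m C1 + b \<cdot>\<^sub>m C0) \<in> carrier_mat (?n + m) ?n"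
    using c by (rule carrier_append_rows)
  fix v :: "complex vec" assume v: "v \<in> carrier_vec ?n"
    and "((a \<cdot>\<^sub>m K1 + b \<cdot>\<^sub>m K0) @\<^sub>r (a \<cdot>\<^sub>m C1 + b \<cdot>\<^sub>m C0)) *\<^sub>v v = 0\<^sub>v (?n + m)"
  then have "((a \<cdot>\<^sub>m K1 + b \<cdot>\<^sub>m K0) *\<^sub>v v) @\<^sub>v ((a \<cdot>\<^sub>m C1 + b \<cdot>\<^sub>m C0) *\<^sub>v v) = 0\<^sub>v ?n @\<^sub>v 0\<^sub>v m"
    by (subst (asm) mat_mult_append[OF c v]) (simp add: zero_append_vec)
  then show "v = 0\<^sub>v ?n"
    using system_kernel[OF v assms] mult_mat_vec_carrier[OF c(1) v] by (subst (asm) append_vec_eq) auto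
qed

text \<open>The adjoint of this block row is the block column at the homogeneous point (cnj b, cnj
  a), so the row condition at z is the column condition at 1 / cnj z, with zero and infinity
  exchanged.\<close>

lemma full_row_rank_system:
  assumes "a \<noteq> 0 \<or> b \<noteq> 0"
  shows "full_row_rank (hcat (a \<cdot>\<^sub>m K1 + b \<cdot>\<^sub>m K0) (a \<cdot>\<^sub>m B1 + b \<cdot>\<^sub>m B0))"
proof (rule full_row_rankI)
  let ?n = "d * m + d * m" and ?a = "cnj a" and ?b = "cnj b"
  have c: "a \<cdot>\<^sub>m K1 + b \<cdot>\<^sub>m K0 \<in> carrier_mat ?n ?n" "a \<cdot>\<^sub>m B1 + b \<cdot>\<^sub>m B0 \<in> carrier_mat ?n m"
    by simp_all
  show "hcat (a \<cdot>\<^sub>m K1 + b \<cdot>\<^sub>m K0) (a \<cdot>\<^sub>m B1 + b \<cdot>\<^sub>m B0) \<in> carrier_mat ?n (?n + m)"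
    using c by (rule hcat_carrier)
  have c': "?b \<cdot>\<^sub>m K1 + ?a \<cdot>\<^sub>m K0 \<in> carrier_mat ?n ?n" "?b \<cdot>\<^sub>m C1 + ?a \<cdot>\<^sub>m C0 \<in> carrier_mat m ?n"
    by simp_all
  have adj: "mat_adjoint (hcat (a \<cdot>\<^sub>m K1 + b \<cdot>\<^sub>m K0) (a \<cdot>\<^sub>m B1 + b \<cdot>\<^sub>m B0)) =
      (?b \<cdot>\<^sub>m K1 + ?a \<cdot>\<^sub>m K0) @\<^sub>r (?b \<cdot>\<^sub>m C1 + ?a \<cdot>\<^sub>m C0)"
    unfolding mat_adjoint_hcat[OF c]
    by (simp add: mat_adjoint_add[of _ ?n ?n] mat_adjoint_add[of _ ?n m] mat_adjoint_smult
        adjoint_blocks comm_add_mat[of _ ?n ?n] comm_add_mat[of _ m ?n])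
  fix v :: "complex vec" assume v: "v \<in> carrier_vec ?n"
    and "mat_adjoint (hcat (a \<cdot>\<^sub>m K1 + b \<cdot>\<^sub>m K0) (a \<cdot>\<^sub>m B1 + b \<cdot>\<^sub>m B0)) *\<^sub>v v = 0\<^sub>v (?n + m)"
  then have "((?b \<cdot>\<^sub>m K1 + ?a \<cdot>\<^sub>m K0) *\<^sub>v v) @\<^sub>v ((?b \<cdot>\<^sub>m C1 + ?a \<cdot>\<^sub>m C0) *\<^sub>v v) = 0\<^sub>v ?n @\<^sub>v 0\<^sub>v m"
    unfolding adj by (subst (asm) mat_mult_append[OF c' v]) (simp add: zero_append_vec)
  then show "v = 0\<^sub>v ?n"
    using system_kernel[OF v, of ?b ?a] assms mult_mat_vec_carrier[OF c'(1) v]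
    by (subst (asm) append_vec_eq) auto
qed

section \<open>The antidiagonal blocks as rational matrices\<close>

definition "M = rat_pencil M1 M0"
definition "N = rat_pencil (mat_adjoint M0) (mat_adjoint M1)"

lemma MN_carrier [simp]:
  "M \<in> carrier_mat (d * m) (d * m)" "N \<in> carrier_mat (d * m) (d * m)"
  by (simp_all add: M_def N_def)

lemma MN_dim [simp]:
  "dim_row M = d * m" "dim_col M = d * m" "dim_row N = d * m" "dim_col N = d * m"
  by (simp_all add: M_def N_def)

text \<open>Blocks are counted from 0 here and from 1 in \<open>M_pencil\<close>, which accounts for
  the shift of the coefficient index by 2.\<close>

lemma M_index:
  assumes "i < d" "r < m" "j < d" "s < m"
  shows "M $$ (i * m + r, j * m + s) =
    rconst (trunc m d R (2 * d - i - j) $$ (r, s)) -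
    (rvar - rconst l) * rconst (trunc m d R (2 * d - 1 - i - j) $$ (r, s))"
proof -
  show ?thesis
    using assms block_index_less[OF assms(1,2)] block_index_less[OF assms(3,4)]
    by (simp add: M_def rat_pencil_index[of _ "d * m" "d * m"] M1_def M0_def hankel_def
        rconst_uminus rconst_hom algebra_simps)
qed

lemma M_pencil_eq: "M_pencil m d l R = M"
proof (rule eq_matI)
  fix a b assume "a < dim_row M" "b < dim_col M"
  then obtain i r j s where ab: "i < d" "r < m" "a = i * m + r" "j < d" "s < m" "b = j * m + s"
    using MN_carrier(1) by (metis block_index_cases carrier_matD)
  then show "M_pencil m d l R $$ (a, b) = M $$ (a, b)"
    using R[of "2 * d - i - j"] R[of "2 * d - 1 - i - j"]
      block_index_less[OF ab(1,2)] block_index_less[OF ab(4,5)]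
    unfolding ab(3,6) M_index[OF ab(1,2,4,5)]
    by (auto simp: M_pencil_def Let_def block_mat_def trunc_def const_mat_def algebra_simps)
qed (auto simp: M_pencil_def block_mat_def M_def Let_def)

lemma rev1_star_M: "rev1 (rat_star M) = N"
  unfolding M_def N_def by (rule rev1_star_rat_pencil[OF carriers(4,5)])

section \<open>The palindromic structure and the invertibility of \<open>M\<close>\<close>

definition "L1 = four_block_mat K1 B1 C1 (R 0)"
definition "L0 = four_block_mat K0 B0 C0 (R 0)"

lemma L_carrier [simp]:
  "L1 \<in> carrier_mat (d * m + d * m + m) (d * m + d * m + m)"
  "L0 \<in> carrier_mat (d * m + d * m + m) (d * m + d * m + m)"
  by (simp_all add: L1_def L0_def)

lemma rat_pencil_blocks:
  "rat_pencil K1 K0 = four_block_mat (0\<^sub>m (d * m) (d * m)) M N (0\<^sub>m (d * m) (d * m))"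
  "rat_pencil B1 B0 = const_mat F @\<^sub>r ((1 + rvar) \<cdot>\<^sub>m const_mat G)"
  "rat_pencil C1 C0 = hcat (rvar \<cdot>\<^sub>m const_mat (mat_adjoint F)) ((1 + rvar) \<cdot>\<^sub>m const_mat (mat_adjoint G))"
  "rat_pencil (R 0) (R 0) = (1 + rvar) \<cdot>\<^sub>m const_mat (R 0)"
proof -
  have "rat_pencil Z Z = 0\<^sub>m (d * m) (d * m)"
    by (intro eq_matI) (auto simp: rat_pencil_def const_mat_def)
  then show "rat_pencil K1 K0 = four_block_mat (0\<^sub>m (d * m) (d * m)) M N (0\<^sub>m (d * m) (d * m))"
    unfolding K1_def K0_def by (subst rat_pencil_four_block) (auto simp: M_def N_def)
  show "rat_pencil B1 B0 = const_mat F @\<^sub>r ((1 + rvar) \<cdot>\<^sub>m const_mat G)"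
    unfolding B1_def B0_def append_rows_def
    by (intro eq_matI) (auto simp: rat_pencil_def const_mat_def algebra_simps)
  show "rat_pencil C1 C0 = hcat (rvar \<cdot>\<^sub>m const_mat (mat_adjoint F)) ((1 + rvar) \<cdot>\<^sub>m const_mat (mat_adjoint G))"
    unfolding C1_def C0_def hcat_def
    by (intro eq_matI) (auto simp: rat_pencil_def const_mat_def algebra_simps)
  show "rat_pencil (R 0) (R 0) = (1 + rvar) \<cdot>\<^sub>m const_mat (R 0)"
    by (intro eq_matI) (auto simp: rat_pencil_def const_mat_def algebra_simps)
qed

lemma L_hat_eq: "L_hat m d l R = rat_pencil L1 L0"
  unfolding L_hat_def Let_def M_pencil_eq rev1_star_M L1_def L0_def
  by (subst rat_pencil_four_block) (auto simp: rat_pencil_blocks)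

lemma star_palindromic_L_hat: "star_palindromic (L_hat m d l R)"
proof -
  \<comment> \<open>The bottom-right block is where \<open>R 0\<close> being Hermitian
    enters.\<close>
  have "mat_adjoint L1 = L0"
    unfolding L1_def L0_def by (subst mat_adjoint_four_block) (auto simp: adjoint_blocks R0)
  moreover from this have "mat_adjoint L0 = L1"
    by (metis mat_adjoint_adjoint)
  ultimately have "rev1 (rat_star (rat_pencil L1 L0)) = rat_pencil L1 L0"
    using rev1_star_rat_pencil[OF L_carrier] by simp
  moreover have "poly_to_rat (pencil L1 L0) = rat_pencil L1 L0"
    by (rule poly_to_rat_pencil[OF L_carrier])
  moreover have "square_mat (rat_pencil L1 L0)"
    using carrier_matD[OF carriers(1)] by (simp add: L0_def)
  moreover have "is_pencil (pencil L1 L0)"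
    by (rule is_pencil_pencil[OF L_carrier])
  ultimately show ?thesis
    unfolding star_palindromic_def L_hat_eq by metis
qed

text \<open>The determinant is a polynomial, so one value suffices. It is nonzero at z = 1 by
  \<open>kernel_M\<close>, because |l| < 1 excludes l = 1.\<close>

lemma M_invertible: obtains Mi where "Mi \<in> carrier_mat (d * m) (d * m)" "M * Mi = 1\<^sub>m (d * m)" "Mi * M = 1\<^sub>m (d * m)"
proof -
  have ev: "comm_ring_hom (\<lambda>p :: complex poly. poly p 1)"
    by unfold_locales auto
  interpret fr: comm_ring_hom "to_fract :: complex poly \<Rightarrow> ratfun"
    by unfold_locales auto
  let ?P = "pencil M1 M0" and ?A = "1 \<cdot>\<^sub>m M1 + 1 \<cdot>\<^sub>m M0"
  have A: "?A \<in> carrier_mat (d * m) (d * m)"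
    by simp
  have "eval_mat ?P 1 = ?A"
    by (subst eval_mat_pencil[of _ "d * m" "d * m"]) (auto intro!: eq_matI)
  moreover have "det ?A \<noteq> 0"
  proof
    assume "det ?A = 0"
    then obtain v where v: "v \<in> carrier_vec (d * m)" "v \<noteq> 0\<^sub>v (d * m)" "?A *\<^sub>v v = 0\<^sub>v (d * m)"
      using det_0_iff_vec_prod_zero_field[OF A] by blast
    have "l \<noteq> 1"
      using l by auto
    then have "v = 0\<^sub>v (d * m)"
      by (intro kernel_M[OF v(1) v(3), of 0]) (use v in auto)
    then show False
      using v by simp
  qed
  ultimately have "poly (det ?P) 1 \<noteq> 0"
    by (simp add: eval_mat_def flip: comm_ring_hom.hom_det[OF ev])
  then have "det ?P \<noteq> 0"
    by auto
  then have "det M \<noteq> 0"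
    using poly_to_rat_pencil[of M1 "d * m" "d * m" M0] fr.hom_det[of ?P]
    by (simp add: M_def poly_to_rat_def)
  then show thesis
    using det_non_zero_imp_unit[OF MN_carrier(1), of "()"] that
    by (auto simp: Units_def ring_mat_def)
qed

section \<open>The transfer function\<close>

text \<open>This is the inverse of \<open>M\<close> times \<open>F\<close>, the only part of that
  inverse which the transfer function requires. The exponent runs from d in the first block to 1 in
  the last.\<close>

definition "X = mat (d * m) m (\<lambda>(a, b). if a mod m = b then - (1 / (rvar - rconst l) ^ (d - a div m)) else 0)"

lemma X_carrier [simp]: "X \<in> carrier_mat (d * m) m"
  by (simp add: X_def)

lemma X_dim [simp]: "dim_row X = d * m" "dim_col X = m"
  by (simp_all add: X_def)

text \<open>The blocks of \<open>X\<close> are scalar multiples of the identity, so each contributes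
  a single entry.\<close>

lemma mult_X_index:
  assumes "A \<in> carrier_mat p (d * m)" "a < p" "b < m"
  shows "(A * X) $$ (a, b) = (\<Sum>j<d. A $$ (a, j * m + b) * - (1 / (rvar - rconst l) ^ (d - j)))"
proof -
  have "(A * X) $$ (a, b) = (\<Sum>j<d. \<Sum>s<m. A $$ (a, j * m + s) * X $$ (j * m + s, b))"
    using assms by (simp add: scalar_prod_def lessThan_atLeast0[symmetric] sum_blocks block_index_less X_def)
  also have "\<dots> = (\<Sum>j<d. \<Sum>s<m. if s = b then A $$ (a, j * m + b) * - (1 / (rvar - rconst l) ^ (d - j)) else 0)"
    using assms by (intro sum.cong refl) (auto simp: X_def block_index_less)
  also have "\<dots> = (\<Sum>j<d. A $$ (a, j * m + b) * - (1 / (rvar - rconst l) ^ (d - j)))"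
    using assms by simp
  finally show ?thesis .
qed

lemma M_mult_X: "M * X = const_mat F"
proof (rule eq_matI)
  fix a b assume "a < dim_row (const_mat F)" "b < dim_col (const_mat F)"
  then have a: "a < d * m" and b: "b < m"
    by (auto simp: const_mat_def)
  obtain i r where ir: "i < d" "r < m" "a = i * m + r"
    using block_index_cases[OF a] by metis
  define s where "s = rvar - rconst l"
  have s: "s \<noteq> 0"
    unfolding s_def by (rule rvar_ne_rconst)
  define T where "T k = rconst (trunc m d R k $$ (r, b))" for k
  \<comment> \<open>Multiplication by \<open>s\<close> lowers the exponent d - j to that of the next
    block, while the coefficient index drops by one too; the second term of summand j is therefore
    \<open>g (Suc j)\<close>.\<close>
  define g where "g j = T (2 * d - i - j) * - (1 / s ^ (d - j))" for j
  have "(M * X) $$ (a, b) = (\<Sum>j<d. (T (2 * d - i - j) - s * T (2 * d - 1 - i - j)) * - (1 / s ^ (d - j)))"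
    using a b ir by (subst mult_X_index[OF MN_carrier(1)]) (auto simp: M_index T_def s_def)
  also have "\<dots> = (\<Sum>j<d. g j - g (Suc j))"
  proof (intro sum.cong refl)
    fix j assume "j \<in> {..<d}"
    then have p: "1 / s ^ (d - Suc j) = s * (1 / s ^ (d - j))"
      using s by (simp add: Suc_diff_Suc[symmetric])
    show "(T (2 * d - i - j) - s * T (2 * d - 1 - i - j)) * - (1 / s ^ (d - j)) = g j - g (Suc j)"
      unfolding g_def p by (simp add: algebra_simps)
  qed
  also have "\<dots> = g 0 - g d"
    by (rule sum_lessThan_telescope')
  \<comment> \<open>Its coefficient index 2d - i exceeds d.\<close>
  also have "g 0 = 0"
    using ir b by (simp add: g_def T_def trunc_def)
  also have "0 - g d = T (d - i)"
    by (simp add: g_def)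
  also have "\<dots> = const_mat F $$ (a, b)"
    using ir b a by (simp add: T_def trunc_def const_mat_def F_mat_def block_mat_def)
  finally show "(M * X) $$ (a, b) = const_mat F $$ (a, b)" .
qed (auto simp: const_mat_def X_def M_def)

text \<open>Block j of the row is R_{d-j} and meets the power d - j of 1/(z - l); summing over k = d
  - j gives the pole part.\<close>

lemma adjoint_G_mult_X: "const_mat (mat_adjoint G) * X = - pole_part m d l R"
proof (rule eq_matI)
  fix a b assume "a < dim_row (- pole_part m d l R)" "b < dim_col (- pole_part m d l R)"
  then have ab: "a < m" "b < m"
    by (auto simp: pole_part_def)
  let ?f = "\<lambda>k. rconst (R k $$ (a, b)) / (rvar - rconst l) ^ k"
  have c: "const_mat (mat_adjoint G) \<in> carrier_mat m (d * m)"
    by simp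
  have "(const_mat (mat_adjoint G) * X) $$ (a, b) = (\<Sum>j<d. - ?f (d - j))"
    using ab unfolding mult_X_index[OF c ab]
    by (intro sum.cong refl) (simp add: adjoint_G const_mat_def row_blocks_def block_index_less)
  also have "\<dots> = - (\<Sum>k=1..d. ?f k)"
    unfolding sum_negf
    by (intro arg_cong[of _ _ uminus] sum.reindex_bij_witness[of _ "\<lambda>k. d - k" "\<lambda>j. d - j"]) auto
  finally show "(const_mat (mat_adjoint G) * X) $$ (a, b) = (- pole_part m d l R) $$ (a, b)"
    using ab by (simp add: pole_part_def)
qed (auto simp: pole_part_def const_mat_def X_def)

section \<open>Strong minimality and the transfer function of the system\<close>

definition "sysA = pencil (- K1) (- K0)"

lemma sysA_carrier [simp]: "sysA \<in> carrier_mat (d * m + d * m) (d * m + d * m)"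
  by (simp add: sysA_def)

text \<open>\<open>system_matrix\<close> negates its first argument, so \<open>sysA\<close> has the
  sign opposite to the block of \<open>L_hat\<close>.\<close>

lemma uminus_sysA: "- sysA = pencil K1 K0"
  by (simp add: sysA_def uminus_pencil[of _ "d * m + d * m" "d * m + d * m"])

lemma minimal_sysA: "minimal_system sysA (pencil B1 B0) (pencil C1 C0)"
  and minimal_at_infinity_sysA: "minimal_at_infinity sysA (pencil B1 B0) (pencil C1 C0)"
proof -
  let ?n = "d * m + d * m"
  \<comment> \<open>The factor 1 matches the homogeneous rank lemmas at the point (z, 1).\<close>
  have "- eval_mat sysA z = z \<cdot>\<^sub>m K1 + 1 \<cdot>\<^sub>m K0" "eval_mat (pencil B1 B0) z = z \<cdot>\<^sub>m B1 + 1 \<cdot>\<^sub>m B0"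
    "eval_mat (pencil C1 C0) z = z \<cdot>\<^sub>m C1 + 1 \<cdot>\<^sub>m C0" for z
  proof -
    show "- eval_mat sysA z = z \<cdot>\<^sub>m K1 + 1 \<cdot>\<^sub>m K0"
      unfolding sysA_def by (subst eval_mat_pencil[of _ ?n ?n]) (auto intro!: eq_matI)
    show "eval_mat (pencil B1 B0) z = z \<cdot>\<^sub>m B1 + 1 \<cdot>\<^sub>m B0"
      by (subst eval_mat_pencil[of _ ?n m]) (auto intro!: eq_matI)
    show "eval_mat (pencil C1 C0) z = z \<cdot>\<^sub>m C1 + 1 \<cdot>\<^sub>m C0"
      by (subst eval_mat_pencil[of _ m ?n]) (auto intro!: eq_matI)
  qed
  then show "minimal_system sysA (pencil B1 B0) (pencil C1 C0)"
    unfolding minimal_system_def using full_row_rank_system full_column_rank_system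
    by (metis zero_neq_one)
  \<comment> \<open>Infinity is the homogeneous point (1, 0).\<close>
  have "- pencil_lead sysA = 1 \<cdot>\<^sub>m K1 + 0 \<cdot>\<^sub>m K0" "pencil_lead (pencil B1 B0) = 1 \<cdot>\<^sub>m B1 + 0 \<cdot>\<^sub>m B0"
    "pencil_lead (pencil C1 C0) = 1 \<cdot>\<^sub>m C1 + 0 \<cdot>\<^sub>m C0"
    unfolding sysA_def pencil_lead_pencil by (auto intro!: eq_matI)
  then show "minimal_at_infinity sysA (pencil B1 B0) (pencil C1 C0)"
    unfolding minimal_at_infinity_def using full_row_rank_system full_column_rank_system
    by (metis zero_neq_one)
qed

lemma L_hat_eq_system_matrix:
  "L_hat m d l R = poly_to_rat (system_matrix sysA (pencil B1 B0) (pencil C1 C0) (pencil (R 0) (R 0)))"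
proof -
  have "system_matrix sysA (pencil B1 B0) (pencil C1 C0) (pencil (R 0) (R 0)) = pencil L1 L0"
    unfolding system_matrix_def uminus_sysA L1_def L0_def by (rule pencil_four_block[OF carriers(6,8,10,1,7,9,11,1), symmetric])
  then show ?thesis
    by (simp add: L_hat_eq poly_to_rat_pencil[OF L_carrier])
qed

text \<open>\<open>N\<close> is z times the para-adjoint of \<open>M\<close>, and the para-adjoint
  respects inverses.\<close>

lemma N_inverse:
  assumes "Mi \<in> carrier_mat (d * m) (d * m)" "M * Mi = 1\<^sub>m (d * m)" "Mi * M = 1\<^sub>m (d * m)"
  defines "Ni \<equiv> (1 / rvar) \<cdot>\<^sub>m para_adjoint Mi"
  shows "Ni \<in> carrier_mat (d * m) (d * m)" "N * Ni = 1\<^sub>m (d * m)" "Ni * N = 1\<^sub>m (d * m)"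
proof -
  let ?n = "d * m"
  have N: "N = rvar \<cdot>\<^sub>m para_adjoint M"
    by (simp flip: rev1_star_M add: rev1_star_eq_para_adjoint)
  have one: "para_adjoint (1\<^sub>m ?n) = 1\<^sub>m ?n"
    using para_conj_rconst[of 1] by (intro eq_matI) (auto simp: para_adjoint_index)
  note c = para_adjoint_carrier[OF MN_carrier(1)] para_adjoint_carrier[OF assms(1)]
  show "Ni \<in> carrier_mat ?n ?n"
    using c by (simp add: Ni_def)
  have "N * Ni = para_adjoint M * para_adjoint Mi"
    using c by (simp add: N Ni_def mult_smult_assoc_mat[of _ ?n ?n _ ?n] mult_smult_distrib[of _ ?n ?n _ ?n]
        smult_smult_mat one_smult_mat)
  also have "para_adjoint M * para_adjoint Mi = 1\<^sub>m ?n"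
    using para_adjoint_mult[OF assms(1) MN_carrier(1)] assms one by simp
  finally show "N * Ni = 1\<^sub>m ?n"
    .
  have "Ni * N = para_adjoint Mi * para_adjoint M"
    using c by (simp add: N Ni_def mult_smult_assoc_mat[of _ ?n ?n _ ?n] mult_smult_distrib[of _ ?n ?n _ ?n]
        smult_smult_mat one_smult_mat)
  also have "para_adjoint Mi * para_adjoint M = 1\<^sub>m ?n"
    using para_adjoint_mult[OF MN_carrier(1) assms(1)] assms one by simp
  finally show "Ni * N = 1\<^sub>m ?n"
    .
qed

text \<open>The \<open>G\<close> row meets the inverse of \<open>M\<close> applied to
  \<open>F\<close> and gives the pole part; the \<open>F\<close> row times the inverse of
  \<open>N\<close>, applied to \<open>G\<close>, gives its para-adjoint. The sign of
  \<open>sysA\<close> cancels that of \<open>X\<close>.\<close>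

lemma transfer_function_sysA:
  "det sysA \<noteq> 0"
  "transfer_function sysA (pencil B1 B0) (pencil C1 C0) (pencil (R 0) (R 0)) =
    (1 + rvar) \<cdot>\<^sub>m (pole_part m d l R + const_mat (R 0) + para_adjoint (pole_part m d l R))"
proof -
  let ?n = "d * m" and ?z = "rvar" and ?w = "1 + rvar" and ?Z = "0\<^sub>m (d * m) (d * m) :: ratmat"
  let ?F = "const_mat F" and ?G = "const_mat G" and ?P = "pole_part m d l R"
  let ?Fs = "const_mat (mat_adjoint F)" and ?Gs = "const_mat (mat_adjoint G)"
  obtain Mi where Mi: "Mi \<in> carrier_mat ?n ?n" "M * Mi = 1\<^sub>m ?n" "Mi * M = 1\<^sub>m ?n"
    by (rule M_invertible)
  define Ni where "Ni = (1 / rvar) \<cdot>\<^sub>m para_adjoint Mi"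
  note Ni = N_inverse[OF Mi, folded Ni_def]
  have cP: "?P \<in> carrier_mat m m"
    by (simp add: pole_part_def)
  have c: "?F \<in> carrier_mat ?n m" "?G \<in> carrier_mat ?n m" "?Fs \<in> carrier_mat m ?n" "?Gs \<in> carrier_mat m ?n"
    by simp_all
  define A where "A = poly_to_rat sysA"
  \<comment> \<open>Inverting an antidiagonal block matrix exchanges the positions of the two
    inverses.\<close>
  define W where "W = four_block_mat ?Z (- Ni) (- Mi) ?Z"
  have A: "A = four_block_mat ?Z (- M) (- N) ?Z"
  proof -
    have "A = - rat_pencil K1 K0"
      unfolding A_def sysA_def
      by (subst poly_to_rat_pencil[of _ "?n + ?n" "?n + ?n"])
        (auto intro!: eq_matI simp: rat_pencil_def const_mat_def rconst_uminus)
    then show ?thesis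
      unfolding rat_pencil_blocks using MN_carrier by (intro eq_matI) auto
  qed
  have Ac: "A \<in> carrier_mat (?n + ?n) (?n + ?n)" and Wc: "W \<in> carrier_mat (?n + ?n) (?n + ?n)"
    using Mi Ni by (auto simp: A W_def)
  have mm: "- X * - Y = X * Y" if "X \<in> carrier_mat ?n ?n" "Y \<in> carrier_mat ?n ?n" for X Y :: ratmat
    using that by (intro eq_matI) auto
  have AW: "A * W = 1\<^sub>m (?n + ?n)"
    unfolding A W_def using Mi Ni
    by (subst four_block_antidiag_mult) (auto simp: mm)
  have det: "det A \<noteq> 0"
    using det_mult[OF Ac Wc] AW by auto
  interpret fr: comm_ring_hom "to_fract :: complex poly \<Rightarrow> ratfun"
    by unfold_locales auto
  show "det sysA \<noteq> 0"
    using det fr.hom_det[of sysA] by (auto simp: A_def poly_to_rat_def)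
  \<comment> \<open>\<open>mat_inverse\<close> succeeds since \<open>A\<close> is a unit, and any
    left inverse agrees with the right inverse \<open>W\<close>.\<close>
  have inv: "the (mat_inverse A) = W"
  proof (cases "mat_inverse A")
    case None
    then show ?thesis
      using mat_inverse(1)[OF Ac, of "()"] det_non_zero_imp_unit[OF Ac det, of "()"] by simp
  next
    case (Some V)
    then have V: "V * A = 1\<^sub>m (?n + ?n)" "V \<in> carrier_mat (?n + ?n) (?n + ?n)"
      using mat_inverse(2)[OF Ac] by auto
    have "V = V * (A * W)"
      using V by (simp add: AW)
    also have "\<dots> = (V * A) * W"
      using V Ac Wc by (intro assoc_mult_mat[symmetric])
    also have "\<dots> = W"
      using V Wc by simp
    finally show ?thesis
      using Some by simp
  qed
  have MiF: "Mi * ?F = X"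
    using Mi MN_carrier left_mult_one_mat[OF X_carrier] by (simp flip: M_mult_X add: assoc_mult_mat[of _ ?n ?n _ ?n _ m, symmetric])
  \<comment> \<open>The para-adjoint of \<open>M * X = const_mat F\<close>; the factor z completes
    the para-adjoint of \<open>M\<close> to \<open>N\<close>, which then cancels.\<close>
  have FNi: "(?z \<cdot>\<^sub>m ?Fs) * Ni = para_adjoint X"
  proof -
    have "?Fs = para_adjoint X * para_adjoint M"
      using para_adjoint_mult[OF MN_carrier(1) X_carrier]
      by (simp add: M_mult_X para_adjoint_const_mat)
    then have "?z \<cdot>\<^sub>m ?Fs = para_adjoint X * N"
      using para_adjoint_carrier[OF X_carrier] para_adjoint_carrier[OF MN_carrier(1)]
      by (simp flip: rev1_star_M add: rev1_star_eq_para_adjoint mult_smult_distrib[of _ m ?n _ ?n])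
    then show ?thesis
      using Ni right_mult_one_mat[OF para_adjoint_carrier[OF X_carrier]] MN_carrier
      by (simp add: assoc_mult_mat[of _ m ?n _ ?n _ ?n])
  qed
  \<comment> \<open>The para-adjoint of \<open>adjoint_G_mult_X\<close>.\<close>
  have XG: "para_adjoint X * ?G = - para_adjoint ?P"
  proof -
    have "para_adjoint X * ?G = para_adjoint (?Gs * X)"
      using para_adjoint_mult[OF c(4) X_carrier] by (simp add: para_adjoint_const_mat)
    also have "\<dots> = - para_adjoint ?P"
      unfolding adjoint_G_mult_X by (intro eq_matI) (auto simp: para_adjoint_index para_conj_uminus)
    finally show ?thesis .
  qed
  have "transfer_function sysA (pencil B1 B0) (pencil C1 C0) (pencil (R 0) (R 0)) =
      rat_pencil (R 0) (R 0) + rat_pencil C1 C0 * W * rat_pencil B1 B0"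
    unfolding transfer_function_def A_def[symmetric] inv
    by (simp add: poly_to_rat_pencil[OF carriers(1,1)] poly_to_rat_pencil[OF carriers(10,11)]
        poly_to_rat_pencil[OF carriers(8,9)])
  also have "rat_pencil C1 C0 * W * rat_pencil B1 B0 =
      (?w \<cdot>\<^sub>m ?Gs) * (- Mi) * ?F + (?z \<cdot>\<^sub>m ?Fs) * (- Ni) * (?w \<cdot>\<^sub>m ?G)"
    unfolding rat_pencil_blocks W_def
    by (rule hcat_mult_antidiag_mult_append_rows[where p = m and q = m]) (use Mi Ni c in auto)
  also have "(?w \<cdot>\<^sub>m ?Gs) * (- Mi) * ?F = ?w \<cdot>\<^sub>m ?P"
  proof -
    have "(?w \<cdot>\<^sub>m ?Gs) * (- Mi) * ?F = (?w \<cdot>\<^sub>m ?Gs) * (- Mi * ?F)"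
      by (rule assoc_mult_mat[of _ m ?n _ ?n _ m]) (use Mi in auto)
    also have "- Mi * ?F = - X"
      unfolding MiF[symmetric] by (rule uminus_mult_left_mat) (use Mi in auto)
    also have "(?w \<cdot>\<^sub>m ?Gs) * - X = - (?w \<cdot>\<^sub>m (?Gs * X))"
      using c by (simp add: mult_smult_assoc_mat[of _ m ?n _ m])
    also have "\<dots> = ?w \<cdot>\<^sub>m ?P"
      unfolding adjoint_G_mult_X by (intro eq_matI) auto
    finally show ?thesis .
  qed
  also have "(?z \<cdot>\<^sub>m ?Fs) * (- Ni) * (?w \<cdot>\<^sub>m ?G) = ?w \<cdot>\<^sub>m para_adjoint ?P"
  proof -
    have "(?z \<cdot>\<^sub>m ?Fs) * (- Ni) = - para_adjoint X"
      unfolding FNi[symmetric] by (rule uminus_mult_right_mat) (use Ni in auto)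
    then have "(?z \<cdot>\<^sub>m ?Fs) * (- Ni) * (?w \<cdot>\<^sub>m ?G) = - (?w \<cdot>\<^sub>m (para_adjoint X * ?G))"
      using c para_adjoint_carrier[OF X_carrier]
      by (simp add: mult_smult_distrib[of _ m ?n _ m] smult_uminus_mat)
    also have "\<dots> = ?w \<cdot>\<^sub>m para_adjoint ?P"
      unfolding XG by (intro eq_matI) auto
    finally show ?thesis .
  qed
  also have "rat_pencil (R 0) (R 0) + (?w \<cdot>\<^sub>m ?P + ?w \<cdot>\<^sub>m para_adjoint ?P) =
      ?w \<cdot>\<^sub>m (?P + const_mat (R 0) + para_adjoint ?P)"
    unfolding rat_pencil_blocks using cP carrier_matD[OF carriers(1)]
    by (intro eq_matI) (auto simp: const_mat_def algebra_simps)
  finally show "transfer_function sysA (pencil B1 B0) (pencil C1 C0) (pencil (R 0) (R 0)) =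
    (1 + rvar) \<cdot>\<^sub>m (pole_part m d l R + const_mat (R 0) + para_adjoint (pole_part m d l R))" .
qed

lemma strongly_minimal_linearization_L_hat:
  "strongly_minimal_linearization (2 * d * m) (L_hat m d l R)
    ((1 + rvar) \<cdot>\<^sub>m (pole_part m d l R + const_mat (R 0) + para_adjoint (pole_part m d l R)))"
proof -
  let ?n = "d * m + d * m"
  have "linear_system sysA (pencil B1 B0) (pencil C1 C0) (pencil (R 0) (R 0))"
    unfolding linear_system_def
  proof (intro conjI exI)
    show "sysA \<in> carrier_mat ?n ?n" "pencil B1 B0 \<in> carrier_mat ?n m"
      "pencil C1 C0 \<in> carrier_mat m ?n" "pencil (R 0) (R 0) \<in> carrier_mat m m"
      by simp_all
    show "is_pencil sysA"
      unfolding sysA_def by (rule is_pencil_pencil[of _ ?n ?n]) simp_all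
    show "is_pencil (pencil B1 B0)" "is_pencil (pencil C1 C0)" "is_pencil (pencil (R 0) (R 0))"
      using carriers by (blast intro: is_pencil_pencil)+
    show "det sysA \<noteq> 0"
      by (rule transfer_function_sysA)
  qed
  moreover have "dim_row sysA = 2 * d * m"
    using carrier_matD(1)[OF sysA_carrier] by (simp add: mult_2 distrib_right)
  ultimately show ?thesis
    unfolding strongly_minimal_linearization_def
    using L_hat_eq_system_matrix minimal_sysA minimal_at_infinity_sysA transfer_function_sysA(2)
    by blast
qed

end

theorem theorem6p4:
  fixes l :: complex and d m :: nat
    and Rc :: "nat \<Rightarrow> complex mat" and R :: "complex poly fract mat"
  assumes "cmod l < 1"
    and "1 \<le> d"
    and "R \<in> carrier_mat m m"
    and "para_hermitian R"
    and "\<And>j. j \<le> d \<Longrightarrow> Rc j \<in> carrier_mat m m"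
    and "R = pole_part m d l Rc + const_mat (Rc 0) + mat_recip (rat_star (pole_part m d l Rc))"
    and "mat_adjoint (Rc 0) = Rc 0"
    and "invertible_mat (Rc d)"
  shows "strongly_minimal_linearization (2 * d * m) (L_hat m d l Rc) ((1 + rvar) \<cdot>\<^sub>m R)
       \<and> star_palindromic (L_hat m d l Rc)"
proof -
  interpret palindromic_pencil m d l Rc
    by unfold_locales (use assms in auto)
  show ?thesis
    using strongly_minimal_linearization_L_hat star_palindromic_L_hat assms(6)
    by (simp add: para_adjoint_def)
qed

end
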